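(* Suppose $(M,g)$ is a compact $n$-dimensional Riemannian manifold with corners, let $\{U_i\}_{i=1}^N$ be a finite cover of $M$ by open sets each possessing a smooth embedding $\phi_i:U_i\to\mathbb{R}^{K_i}$ for some integer $K_i$, and let $V_i\subset U_i$ be another cover of $M$ where each $V_i$ is closed. Suppose $M$ supports a family of Regge metrics $\{(M,\mathcal{T}_h,g_h)\}_{h\in S}$ ($S\subset\mathbb{R}$), parametrized so that $\max_{T}C_{g_h,\hat\delta}(T)=h$, such that: 1. there exists $C<\infty$ such that $C_{g,g_h}(M)\,C_{g_h,g}(M)\le C$ for all $h\in S$; 2. every $n$-simplex $T$ is contained completely in $V_i$ for some index $i$; 3. for each $h\in S$ and $T\in\mathcal{T}_h$ (an $n$-simplex contained in $V_i$) there exists a one-to-one affine map $\tilde f_{h,T}:\mathbb{R}^n\to\mathbb{R}^{K_i}$ such that $\tilde f_{h,T}(\hat T)=\phi_i(T)$ (by abuse of notation, $\tilde f_{h,T}$ also denotes the linear map $v\mapsto\tilde f_{h,T}(v)-\tilde f_{h,T}(0)$); 4. there exists $0<K<\infty$ such that $$\frac{\sup_{v\ne0}\|\tilde f_{h,T}v\|/\|v\|}{\inf_{w\ne0}\|\tilde f_{h,T}w\|/\|w\|}\le K\qquad\text{for all }h\in S,\ T\in\mathcal{T}_h;$$ 5. $C_{g,g_h}(T)\le C$ for all $h\in S$, $T\in\mathcal{T}_h$; 6. there exists $0<K'<\infty$ such that $0<\frac{1}{K'}h\le\inf_{v\ne0}\frac{\|\tilde f_{h,T}v\|}{\|v\|}$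 for all $h\in S$, $T\in\mathcal{T}_h$. Then $\{(M,\mathcal{T}_h,g_h)\}_{h\in S}$ has the Riemannian quasi-uniformity property.
   Context: $\hat T=\{x\in\mathbb{R}^n:\sum_i x^i\le1,\ 0\le x^i\le1\}$ is the standard simplex and $\delta$ the Euclidean metric on it. $T$ always denotes an $n$-simplex of a triangulation. The diffeomorphisms used in the statement are $f_{h,T}=\phi_i^{-1}\circ\tilde f_{h,T}:\hat T\to T$, and $\hat\delta=(f_{h,T}^{-1})^*\delta$. Regge metrics. A smooth countable triangulation $\mathcal{T}$ of a smooth oriented $n$-manifold $M$ (possibly with corners) is a countable cover of $M$ by closed sets $\Delta$, each the image of a smooth embedding of a standard $k$-simplex for some $0\le k\le n$, such that every face of a simplex of $\mathcal{T}$ is in $\mathcal{T}$, the intersection of two simplices is empty or a face of both, and any simplex whose relative interior meets a stratum of $\partial M$ lies fully in that stratum. A Regge metric $g$ for $\mathcal{T}$ is a smooth Riemannian metric $g_\Delta$ on each $\Delta\in\mathcal{T}$ with $i_f^*g_\Delta=g_f$ for each face $f\subset\Delta$. Every smooth metric is a Regge metric. Comparison constant: $C_{g_1,g_2}(\Omega)=\operatorname*{ess\,sup}_{x\in\Omega,\ v\in T_x\Omega\setminus\{0\}}\|v\|_{g_1}/\|v\|_{g_2}$. Riemannian shape-regularity: a family $\{(M_h,\mathcal{T}_h,g_h)\}_{h\in S}$ has this property if there exist $0<K<\infty$ independent of $h$ and orientation-preserving diffeomorphisms $f_{h,T}:\hat T\to T$ for each $n$-simplex $T\in\mathcal{T}_h$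 with $C_{g_h,\hat\delta}(T)C_{\hat\delta,g_h}(T)\le K$ for all $h\in S,T\in\mathcal{T}_h$. Riemannian quasi-uniformity: let $\{(M_h,\mathcal{T}_h,g_h)\}_{h\in S}$ and the maps $f_{h,T}$ be as in the definition of shape-regularity, parametrized so that $\max_{T\subseteq M_h}C_{g_h,\hat\delta}(T)=h$. The family has the Riemannian quasi-uniformity property if there exists $0<K'<\infty$ such that $C_{\hat\delta,g_h}(T)\le K'h^{-1}$ for all $h\in S$, $T\in\mathcal{T}_h$ (this $K'$ need not equal the $K'$ of condition 6). *)

theory Defs
  imports "HOL-Analysis.Analysis"
begin

section \<open>Smooth maps on subsets of Euclidean space\<close>

primrec Ck_on :: "nat \<Rightarrow> ('a::euclidean_space \<Rightarrow> 'b::real_normed_vector) \<Rightarrow> 'a set \<Rightarrow> bool" where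
  "Ck_on 0 f W \<longleftrightarrow> continuous_on W f"
| "Ck_on (Suc k) f W \<longleftrightarrow>
     (\<exists>D. (\<forall>x\<in>W. (f has_derivative D x) (at x)) \<and> (\<forall>v. Ck_on k (\<lambda>x. D x v) W))"

text \<open>On a set that need not be open, smooth means: locally the restriction of a
  \<open>C\<^sup>\<infinity>\<close> function on an open set.\<close>

definition smooth_on_set :: "'a::euclidean_space set \<Rightarrow> ('a \<Rightarrow> 'b::real_normed_vector) \<Rightarrow> bool" where
  "smooth_on_set S f \<longleftrightarrow>
     (\<forall>x\<in>S. \<exists>W F. open W \<and> x \<in> W \<and> (\<forall>k. Ck_on k F W) \<and> (\<forall>y\<in>S \<inter> W. F y = f y))"

abbreviation deriv_within :: "'a::euclidean_space set \<Rightarrow> ('a \<Rightarrow> 'b::real_normed_vector) \<Rightarrow> 'a \<Rightarrow> 'a \<Rightarrow> 'b" where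
  "deriv_within S f x \<equiv> frechet_derivative f (at x within S)"


section \<open>Oriented manifolds with corners\<close>

text \<open>A chart is a pair of a domain and a coordinate map; only the values of the map on the
  domain matter. The component \<open>orient c p\<close> of a manifold is \<open>1\<close> or \<open>-1\<close> according to
  whether the chart \<open>c\<close> is positively oriented at \<open>p\<close>. An orientation is not encoded by an
  atlas of positively oriented charts, because for \<open>n = 1\<close> a chart at a boundary point with
  values in \<open>[0,\<infinity>)\<close> cannot be reversed.\<close>

type_synonym ('m, 'n) chart = "'m set \<times> ('m \<Rightarrow> (real, 'n) vec)"

record ('m, 'n) mfd =
  mtop :: "'m topology"
  atlas :: "('m, 'n) chart set"
  orient :: "('m, 'n) chart \<Rightarrow> 'm \<Rightarrow> real"

definition orthant :: "(real^'n) set" where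
  "orthant = {x. \<forall>i. 0 \<le> x $ i}"

definition second_countable_space :: "'m topology \<Rightarrow> bool" where
  "second_countable_space X \<longleftrightarrow>
     (\<exists>B. countable B \<and> (\<forall>W\<in>B. openin X W) \<and>
          (\<forall>W p. openin X W \<and> p \<in> W \<longrightarrow> (\<exists>W'\<in>B. p \<in> W' \<and> W' \<subseteq> W)))"

definition manifold_with_corners :: "('m, 'n::finite) mfd \<Rightarrow> bool" where
  "manifold_with_corners M \<longleftrightarrow>
     Hausdorff_space (mtop M) \<and> second_countable_space (mtop M) \<and>
     (\<Union>(U, c)\<in>atlas M. U) = topspace (mtop M) \<and>
     (\<forall>(U, c)\<in>atlas M.
        openin (mtop M) U \<and> openin (top_of_set orthant) (c ` U) \<and>
        homeomorphic_map (subtopology (mtop M) U) (top_of_set (c ` U)) c) \<and>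
     (\<forall>(U, c)\<in>atlas M. \<forall>(V, d)\<in>atlas M.
        smooth_on_set (c ` (U \<inter> V)) (d \<circ> inv_into U c))"

definition transition_deriv ::
  "('m, 'n::finite) chart \<Rightarrow> ('m, 'n) chart \<Rightarrow> 'm \<Rightarrow> real^'n \<Rightarrow> real^'n" where
  "transition_deriv a b p =
     deriv_within (snd a ` fst a) (snd b \<circ> inv_into (fst a) (snd a)) (snd a p)"

definition oriented :: "('m, 'n::finite) mfd \<Rightarrow> bool" where
  "oriented M \<longleftrightarrow>
     (\<forall>a\<in>atlas M. \<forall>p\<in>fst a. orient M a p \<in> {-1, 1}) \<and>
     (\<forall>a\<in>atlas M. continuous_map (subtopology (mtop M) (fst a)) euclideanreal (orient M a)) \<and>
     (\<forall>a\<in>atlas M. \<forall>b\<in>atlas M. \<forall>p\<in>fst a \<inter> fst b.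
        orient M b p = sgn (det (matrix (transition_deriv a b p))) * orient M a p)"

text \<open>Strata of the boundary are taken closed: a simplex with relative interior in a boundary
  face may well have a vertex at a corner.\<close>

definition depth_set :: "('m, 'n::finite) mfd \<Rightarrow> nat \<Rightarrow> 'm set" where
  "depth_set M j = {p. \<exists>(U, c)\<in>atlas M. p \<in> U \<and> card {i. c p $ i = 0} = j}"

definition boundary_strata :: "('m, 'n::finite) mfd \<Rightarrow> 'm set set" where
  "boundary_strata M =
     {mtop M closure_of C | C j. 1 \<le> j \<and> C \<in> connected_components_of (subtopology (mtop M) (depth_set M j))}"


section \<open>Tangent vectors\<close>

text \<open>A tangent vector at \<open>p\<close> assigns to every chart around \<open>p\<close> its coordinate vector, with
  the usual transformation law, and the value \<open>0\<close> to everything else.\<close>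

type_synonym ('m, 'n) tvec = "('m, 'n) chart \<Rightarrow> (real, 'n) vec"

definition tangent_space :: "('m, 'n::finite) mfd \<Rightarrow> 'm \<Rightarrow> ('m, 'n) tvec set" where
  "tangent_space M p =
     {X. (\<forall>a. a \<notin> atlas M \<or> p \<notin> fst a \<longrightarrow> X a = 0) \<and>
         (\<forall>a\<in>atlas M. \<forall>b\<in>atlas M. p \<in> fst a \<inter> fst b \<longrightarrow> X b = transition_deriv a b p (X a))}"

text \<open>The differential at \<open>x \<in> S\<close> of a map \<open>F\<close> from a subset \<open>S\<close> of Euclidean space to \<open>M\<close>.\<close>

definition differential ::
  "('m, 'n::finite) mfd \<Rightarrow> (real^'n) set \<Rightarrow> (real^'n \<Rightarrow> 'm) \<Rightarrow> real^'n \<Rightarrow> real^'n \<Rightarrow> ('m, 'n) tvec" where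
  "differential M S F x v =
     (\<lambda>a. if a \<in> atlas M \<and> F x \<in> fst a then deriv_within S (snd a \<circ> F) x v else 0)"

definition smooth_into ::
  "('m, 'n::finite) mfd \<Rightarrow> (real^'n) set \<Rightarrow> (real^'n \<Rightarrow> 'm) \<Rightarrow> bool" where
  "smooth_into M S F \<longleftrightarrow>
     continuous_map (top_of_set S) (mtop M) F \<and>
     (\<forall>(U, c)\<in>atlas M. smooth_on_set (S \<inter> F -` U) (c \<circ> F))"


section \<open>Smooth embeddings of open sets into \<open>\<real>\<^sup>K\<close>\<close>

text \<open>\<open>\<real>\<^sup>K\<close> with \<open>K\<close> not fixed is \<open>Euclidean_space K\<close>, i.e. functions on \<open>nat\<close> that
  vanish from \<open>K\<close> on.\<close>

definition smooth_embedding_into ::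
  "('m, 'n::finite) mfd \<Rightarrow> 'm set \<Rightarrow> nat \<Rightarrow> ('m \<Rightarrow> nat \<Rightarrow> real) \<Rightarrow> bool" where
  "smooth_embedding_into M U K \<phi> \<longleftrightarrow>
     embedding_map (subtopology (mtop M) U) (Euclidean_space K) \<phi> \<and>
     (\<forall>(W, c)\<in>atlas M.
        (\<forall>j<K. smooth_on_set (c ` (W \<inter> U)) (\<lambda>x. \<phi> (inv_into W c x) j)) \<and>
        (\<forall>p\<in>W \<inter> U. \<forall>v.
           (\<forall>j<K. deriv_within (c ` (W \<inter> U)) (\<lambda>x. \<phi> (inv_into W c x) j) (c p) v = 0) \<longrightarrow> v = 0))"

definition affine_map_into :: "nat \<Rightarrow> (real^'n \<Rightarrow> nat \<Rightarrow> real) \<Rightarrow> bool" where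
  "affine_map_into K f \<longleftrightarrow>
     range f \<subseteq> topspace (Euclidean_space K) \<and> (\<forall>j. linear (\<lambda>v. f v j - f 0 j))"

text \<open>\<open>\<parallel>fv\<parallel> / \<parallel>v\<parallel>\<close> for the linear part of an affine map \<open>f\<close>.\<close>

definition stretch :: "nat \<Rightarrow> (real^'n \<Rightarrow> nat \<Rightarrow> real) \<Rightarrow> real^'n \<Rightarrow> real" where
  "stretch K f v = L2_set (\<lambda>j. f v j - f 0 j) {..<K} / norm v"


section \<open>Triangulations\<close>

text \<open>The standard \<open>k\<close>-simplex is realised as the face of the standard \<open>n\<close>-simplex spanned by
  \<open>0\<close> and the axis vectors with index in \<open>I\<close>, where \<open>card I = k\<close>; its tangent space is
  \<open>coord_space I\<close>. The case \<open>I = UNIV\<close> is the standard \<open>n\<close>-simplex.\<close>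

definition coord_space :: "'n set \<Rightarrow> (real^'n) set" where
  "coord_space I = {v. \<forall>i. i \<notin> I \<longrightarrow> v $ i = 0}"

definition std_simplex :: "'n::finite set \<Rightarrow> (real^'n) set" where
  "std_simplex I = {x \<in> coord_space I. (\<Sum>i\<in>UNIV. x $ i) \<le> 1 \<and> (\<forall>i. 0 \<le> x $ i \<and> x $ i \<le> 1)}"

definition embeds_simplex ::
  "('m, 'n::finite) mfd \<Rightarrow> (real^'n \<Rightarrow> 'm) \<Rightarrow> 'n set \<Rightarrow> 'm set \<Rightarrow> bool" where
  "embeds_simplex M F I \<Delta> \<longleftrightarrow>
     F ` std_simplex I = \<Delta> \<and>
     smooth_into M (std_simplex I) F \<and>
     embedding_map (top_of_set (std_simplex I)) (mtop M) F \<and>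
     (\<forall>x\<in>std_simplex I. \<forall>v\<in>coord_space I.
        differential M (std_simplex I) F x v = (\<lambda>_. 0) \<longrightarrow> v = 0)"

definition simplex_face :: "('m, 'n::finite) mfd \<Rightarrow> 'm set \<Rightarrow> 'm set \<Rightarrow> bool" where
  "simplex_face M E \<Delta> \<longleftrightarrow>
     (\<exists>F I G. embeds_simplex M F I \<Delta> \<and> G face_of std_simplex I \<and> G \<noteq> {} \<and> E = F ` G)"

definition smooth_triangulation :: "('m, 'n::finite) mfd \<Rightarrow> 'm set set \<Rightarrow> bool" where
  "smooth_triangulation M \<T> \<longleftrightarrow>
     countable \<T> \<and> \<Union>\<T> = topspace (mtop M) \<and>
     (\<forall>\<Delta>\<in>\<T>. closedin (mtop M) \<Delta> \<and> (\<exists>F I. embeds_simplex M F I \<Delta>)) \<and>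
     (\<forall>\<Delta>\<in>\<T>. \<forall>E. simplex_face M E \<Delta> \<longrightarrow> E \<in> \<T>) \<and>
     (\<forall>\<Delta>\<in>\<T>. \<forall>\<Delta>'\<in>\<T>. \<Delta> \<inter> \<Delta>' = {} \<or>
        simplex_face M (\<Delta> \<inter> \<Delta>') \<Delta> \<and> simplex_face M (\<Delta> \<inter> \<Delta>') \<Delta>') \<and>
     (\<forall>\<Delta>\<in>\<T>. \<forall>F I. embeds_simplex M F I \<Delta> \<longrightarrow>
        (\<forall>Q\<in>boundary_strata M. F ` rel_interior (std_simplex I) \<inter> Q \<noteq> {} \<longrightarrow> \<Delta> \<subseteq> Q))"

definition n_simplices :: "('m, 'n::finite) mfd \<Rightarrow> 'm set set \<Rightarrow> 'm set set" where
  "n_simplices M \<T> = {T \<in> \<T>. \<exists>F. embeds_simplex M F UNIV T}"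

definition simplex_tangent_space ::
  "('m, 'n::finite) mfd \<Rightarrow> 'm set \<Rightarrow> 'm \<Rightarrow> ('m, 'n) tvec set" where
  "simplex_tangent_space M \<Delta> p =
     {differential M (std_simplex I) F x v | F I x v.
        embeds_simplex M F I \<Delta> \<and> x \<in> std_simplex I \<and> F x = p \<and> v \<in> coord_space I}"


section \<open>Riemannian metrics and Regge metrics\<close>

type_synonym ('m, 'n) metric = "'m \<Rightarrow> ('m, 'n) tvec \<Rightarrow> ('m, 'n) tvec \<Rightarrow> real"

definition inner_product_on :: "'a::real_vector set \<Rightarrow> ('a \<Rightarrow> 'a \<Rightarrow> real) \<Rightarrow> bool" where
  "inner_product_on V B \<longleftrightarrow>
     (\<forall>u\<in>V. \<forall>v\<in>V. B u v = B v u) \<and>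
     (\<forall>u\<in>V. \<forall>v\<in>V. \<forall>w\<in>V. \<forall>r s. B (r *\<^sub>R u + s *\<^sub>R v) w = r * B u w + s * B v w) \<and>
     (\<forall>u\<in>V. u \<noteq> 0 \<longrightarrow> 0 < B u u)"

definition pullback_metric ::
  "('m, 'n::finite) mfd \<Rightarrow> (real^'n) set \<Rightarrow> (real^'n \<Rightarrow> 'm) \<Rightarrow> ('m, 'n) metric \<Rightarrow>
     real^'n \<Rightarrow> real^'n \<Rightarrow> real^'n \<Rightarrow> real" where
  "pullback_metric M S F g x v w = g (F x) (differential M S F x v) (differential M S F x w)"

definition smooth_metric_on :: "(real^'n) set \<Rightarrow> (real^'n) set \<Rightarrow>
     (real^'n \<Rightarrow> real^'n \<Rightarrow> real^'n \<Rightarrow> real) \<Rightarrow> bool" where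
  "smooth_metric_on S V G \<longleftrightarrow>
     (\<forall>x\<in>S. inner_product_on V (G x)) \<and> (\<forall>v\<in>V. \<forall>w\<in>V. smooth_on_set S (\<lambda>x. G x v w))"

definition riemannian_metric :: "('m, 'n::finite) mfd \<Rightarrow> ('m, 'n) metric \<Rightarrow> bool" where
  "riemannian_metric M g \<longleftrightarrow>
     (\<forall>(U, c)\<in>atlas M. smooth_metric_on (c ` U) UNIV (pullback_metric M (c ` U) (inv_into U c) g))"

definition riemannian_metric_on_simplex ::
  "('m, 'n::finite) mfd \<Rightarrow> 'm set \<Rightarrow> ('m, 'n) metric \<Rightarrow> bool" where
  "riemannian_metric_on_simplex M \<Delta> g \<longleftrightarrow>
     (\<forall>F I. embeds_simplex M F I \<Delta> \<longrightarrow>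
        smooth_metric_on (std_simplex I) (coord_space I) (pullback_metric M (std_simplex I) F g))"

definition regge_metric ::
  "('m, 'n::finite) mfd \<Rightarrow> 'm set set \<Rightarrow> ('m set \<Rightarrow> ('m, 'n) metric) \<Rightarrow> bool" where
  "regge_metric M \<T> g \<longleftrightarrow>
     (\<forall>\<Delta>\<in>\<T>. riemannian_metric_on_simplex M \<Delta> (g \<Delta>)) \<and>
     (\<forall>\<Delta>\<in>\<T>. \<forall>E. simplex_face M E \<Delta> \<longrightarrow>
        (\<forall>p\<in>E. \<forall>X\<in>simplex_tangent_space M E p. \<forall>Y\<in>simplex_tangent_space M E p.
           g \<Delta> p X Y = g E p X Y))"

text \<open>A Regge metric as a metric on \<open>M\<close>, determined only almost everywhere: the choice of \<open>T\<close>
  is ambiguous on the skeleton of codimension one.\<close>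

definition regge_field ::
  "('m, 'n::finite) mfd \<Rightarrow> 'm set set \<Rightarrow> ('m set \<Rightarrow> ('m, 'n) metric) \<Rightarrow> ('m, 'n) metric" where
  "regge_field M \<T> g p = g (SOME T. T \<in> n_simplices M \<T> \<and> p \<in> T) p"


section \<open>Comparison of metrics\<close>

definition null_in :: "('m, 'n::finite) mfd \<Rightarrow> 'm set \<Rightarrow> bool" where
  "null_in M N \<longleftrightarrow> (\<forall>(U, c)\<in>atlas M. negligible (c ` (N \<inter> U)))"

definition metric_norm :: "('m, 'n) metric \<Rightarrow> 'm \<Rightarrow> ('m, 'n) tvec \<Rightarrow> real" where
  "metric_norm g p X = sqrt (g p X X)"

text \<open>The essential supremum discards null sets of points \<open>p\<close>, not of tangent vectors. It is
  only used for \<open>\<Omega> = M\<close> and for \<open>\<Omega>\<close> an \<open>n\<close>-simplex, so that the tangent space of \<open>\<Omega>\<close> at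
  \<open>p\<close> is that of \<open>M\<close>.\<close>

definition comparison ::
  "('m, 'n::finite) mfd \<Rightarrow> ('m, 'n) metric \<Rightarrow> ('m, 'n) metric \<Rightarrow> 'm set \<Rightarrow> ereal" where
  "comparison M g1 g2 \<Omega> =
     Inf {a. null_in M {p \<in> \<Omega>. \<exists>X\<in>tangent_space M p - {\<lambda>_. 0}.
                          a < ereal (metric_norm g1 p X / metric_norm g2 p X)}}"

text \<open>The metric \<open>(f\<^sup>-\<^sup>1)\<^sup>*\<delta>\<close> on \<open>f(std_simplex UNIV)\<close>; the differential of \<open>f\<^sup>-\<^sup>1\<close> at \<open>f x\<close> is the
  inverse of the differential of \<open>f\<close> at \<open>x\<close>.\<close>

definition hat_metric :: "('m, 'n::finite) mfd \<Rightarrow> (real^'n \<Rightarrow> 'm) \<Rightarrow> ('m, 'n) metric" where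
  "hat_metric M f p X Y =
     (let x = inv_into (std_simplex UNIV) f p;
          df_inv = inv (differential M (std_simplex UNIV) f x)
      in df_inv X \<bullet> df_inv Y)"


section \<open>Shape regularity and quasi-uniformity\<close>

definition diffeo_simplex ::
  "('m, 'n::finite) mfd \<Rightarrow> (real^'n \<Rightarrow> 'm) \<Rightarrow> 'm set \<Rightarrow> bool" where
  "diffeo_simplex M f T \<longleftrightarrow>
     bij_betw f (std_simplex UNIV) T \<and> smooth_into M (std_simplex UNIV) f \<and>
     (\<forall>(U, c)\<in>atlas M.
        smooth_on_set (c ` (T \<inter> U)) (inv_into (std_simplex UNIV) f \<circ> inv_into U c))"

definition orientation_preserving :: "('m, 'n::finite) mfd \<Rightarrow> (real^'n \<Rightarrow> 'm) \<Rightarrow> bool" where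
  "orientation_preserving M f \<longleftrightarrow>
     (\<forall>x\<in>std_simplex UNIV. \<forall>a\<in>atlas M. f x \<in> fst a \<longrightarrow>
        sgn (det (matrix (deriv_within (std_simplex UNIV) (snd a \<circ> f) x))) = orient M a (f x))"

text \<open>Families \<open>(M h, \<T> h, g h)\<close> indexed by \<open>h \<in> S\<close>, with reference maps \<open>f h T\<close>.\<close>

definition shape_regular_with ::
  "real set \<Rightarrow> (real \<Rightarrow> ('m, 'n::finite) mfd) \<Rightarrow> (real \<Rightarrow> 'm set set) \<Rightarrow>
     (real \<Rightarrow> 'm set \<Rightarrow> ('m, 'n) metric) \<Rightarrow> (real \<Rightarrow> 'm set \<Rightarrow> real^'n \<Rightarrow> 'm) \<Rightarrow> bool" where
  "shape_regular_with S M \<T> g f \<longleftrightarrow>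
     (\<exists>K::real. 0 < K \<and>
        (\<forall>h\<in>S. \<forall>T\<in>n_simplices (M h) (\<T> h).
           diffeo_simplex (M h) (f h T) T \<and> orientation_preserving (M h) (f h T) \<and>
           comparison (M h) (g h T) (hat_metric (M h) (f h T)) T *
           comparison (M h) (hat_metric (M h) (f h T)) (g h T) T \<le> ereal K))"

definition parametrized_by_size ::
  "real set \<Rightarrow> (real \<Rightarrow> ('m, 'n::finite) mfd) \<Rightarrow> (real \<Rightarrow> 'm set set) \<Rightarrow>
     (real \<Rightarrow> 'm set \<Rightarrow> ('m, 'n) metric) \<Rightarrow> (real \<Rightarrow> 'm set \<Rightarrow> real^'n \<Rightarrow> 'm) \<Rightarrow> bool" where
  "parametrized_by_size S M \<T> g f \<longleftrightarrow>
     (\<forall>h\<in>S.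
        (\<forall>T\<in>n_simplices (M h) (\<T> h).
           comparison (M h) (g h T) (hat_metric (M h) (f h T)) T \<le> ereal h) \<and>
        (\<exists>T\<in>n_simplices (M h) (\<T> h).
           comparison (M h) (g h T) (hat_metric (M h) (f h T)) T = ereal h))"

definition quasi_uniform ::
  "real set \<Rightarrow> (real \<Rightarrow> ('m, 'n::finite) mfd) \<Rightarrow> (real \<Rightarrow> 'm set set) \<Rightarrow>
     (real \<Rightarrow> 'm set \<Rightarrow> ('m, 'n) metric) \<Rightarrow> bool" where
  "quasi_uniform S M \<T> g \<longleftrightarrow>
     (\<exists>f. shape_regular_with S M \<T> g f \<and> parametrized_by_size S M \<T> g f \<and>
        (\<exists>K'::real. 0 < K' \<and>
           (\<forall>h\<in>S. \<forall>T\<in>n_simplices (M h) (\<T> h).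
              comparison (M h) (hat_metric (M h) (f h T)) (g h T) T \<le> ereal (K' * inverse h))))"

end

theory Submission
  imports Defs
begin

text \<open>The reference map \<open>f = \<phi>\<^sub>i\<^sup>-\<^sup>1 \<circ> ft\<close> of an \<open>n\<close>-simplex \<open>T\<close> straightens the embedding: \<open>\<phi>\<^sub>i \<circ> f\<close> is the affine
  map \<open>ft\<close>. A tangent vector \<open>X = df(v)\<close> therefore has hat norm \<open>|v|\<close>, and \<open>d\<phi>\<^sub>i(X)\<close> is the linear part
  of \<open>ft\<close> applied to \<open>v\<close>. Three estimates combine. The lower bound \<open>h / K'\<close> on the singular values of \<open>ft\<close>
  gives \<open>|X|\<^sub>h\<^sub>a\<^sub>t \<le> (K' / h) |d\<phi>\<^sub>i(X)|\<close> (\<open>hat_norm_le\<close>). On the compact set \<open>V\<^sub>i\<close> the Euclidean metric pulled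
  back by \<open>\<phi>\<^sub>i\<close> is dominated by a constant multiple of \<open>g\<close>, because a quotient of continuous quadratic
  forms is bounded on a compact unit sphere bundle (\<open>embedding_bound_on_compact\<close>). Finally the
  comparison of \<open>g\<close> with \<open>g\<^sub>h\<close> on \<open>T\<close> bounds \<open>|X|\<^sub>g\<close> by a multiple of the \<open>g\<^sub>h\<close>-norm outside a null set.
  Hence the constant comparing the hat metric with \<open>g\<^sub>h\<close> is at most \<open>L / h\<close> with one \<open>L\<close> for all \<open>h\<close> and \<open>T\<close>, which is
  quasi-uniformity. The parametrization by size says that the opposite constant is at most \<open>h\<close>, so the
  product of the two is at most \<open>L\<close>, which is shape regularity. Multiplying extended reals in this
  way requires both constants to be non-negative, which holds because \<open>T\<close> is not a null set
  (\<open>T_not_null\<close>).\<close>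

text \<open>It remains to see that the reference maps are orientation-preserving diffeomorphisms. Smoothness of
  \<open>f\<close> amounts to smoothness of \<open>\<phi>\<^sub>i\<^sup>-\<^sup>1\<close> along \<open>ft\<close>, which follows from a \<open>C\<^sup>\<infinity>\<close> inverse function theorem
  (\<open>smooth_local_inverse\<close>) applied to a suitable projection of \<open>\<phi>\<^sub>i\<close> to \<open>\<real>\<^sup>n\<close> (\<open>f_smooth_in_chart\<close>). The sign
  by which \<open>f\<close> changes the orientation is constant on the simplex (\<open>orientation_sign_constant\<close>). If it
  is negative, \<open>f\<close> is precomposed with a Euclidean isometry of the standard simplex that reverses
  orientation (\<open>oriented_reference_map\<close>); the hat metric, hence every comparison constant, stays the
  same.\<close>

section \<open>Calculus of \<open>C\<^sup>k\<close> functions\<close>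

lemma Ck_on_subset: "Ck_on k f W \<Longrightarrow> W' \<subseteq> W \<Longrightarrow> Ck_on k f W'"
proof (induction k arbitrary: f)
  case (Suc k)
  then show ?case by simp (meson subsetD)
qed (auto intro: continuous_on_subset)

lemma Ck_on_imp_continuous_on: "Ck_on k f W \<Longrightarrow> continuous_on W f"
  by (cases k) (auto intro!: continuous_at_imp_continuous_on dest: has_derivative_continuous)

lemma Ck_on_Suc_imp: "Ck_on (Suc k) f W \<Longrightarrow> Ck_on k f W"
proof (induction k arbitrary: f)
  case 0
  then show ?case using Ck_on_imp_continuous_on by (metis Ck_on.simps(1))
next
  case (Suc k)
  then show ?case by (metis Ck_on.simps(2))
qed

lemma Ck_on_cong:
  assumes "open W" "\<And>x. x \<in> W \<Longrightarrow> f x = g x" "Ck_on k f W"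
  shows "Ck_on k g W"
proof (cases k)
  case 0
  then show ?thesis using assms by (metis Ck_on.simps(1) continuous_on_cong)
next
  case (Suc m)
  then obtain D where D: "\<forall>x\<in>W. (f has_derivative D x) (at x)" "\<forall>v. Ck_on m (\<lambda>x. D x v) W"
    using assms(3) by auto
  then have "\<forall>x\<in>W. (g has_derivative D x) (at x)"
    using assms by (blast intro: has_derivative_transform_within_open)
  with D Suc show ?thesis by auto
qed

lemma Ck_on_const: "Ck_on k (\<lambda>x. c) W"
proof (induction k arbitrary: c)
  case (Suc k)
  then show ?case by simp (rule exI[of _ "\<lambda>x v. 0"], auto)
qed auto

lemma Ck_on_add: "Ck_on k f W \<Longrightarrow> Ck_on k g W \<Longrightarrow> Ck_on k (\<lambda>x. f x + g x) W"
proof (induction k arbitrary: f g)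
  case (Suc k)
  obtain D E where "\<forall>x\<in>W. (f has_derivative D x) (at x)" "\<forall>v. Ck_on k (\<lambda>x. D x v) W"
    "\<forall>x\<in>W. (g has_derivative E x) (at x)" "\<forall>v. Ck_on k (\<lambda>x. E x v) W"
    using Suc.prems by auto
  with Suc.IH show ?case
    by (auto intro!: exI[of _ "\<lambda>x v. D x v + E x v"] has_derivative_add)
qed (auto intro: continuous_on_add)

lemma Ck_on_sum:
  "(\<And>i. i \<in> I \<Longrightarrow> Ck_on k (f i) W) \<Longrightarrow> Ck_on k (\<lambda>x. \<Sum>i\<in>I. f i x) W"
  by (induction I rule: infinite_finite_induct) (auto intro: Ck_on_const Ck_on_add)

lemma Ck_on_bounded_linear_comp:
  assumes "bounded_linear L"
  shows "Ck_on k f W \<Longrightarrow> Ck_on k (\<lambda>x. L (f x)) W"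
proof (induction k arbitrary: f)
  case 0
  then show ?case using assms by (auto intro: bounded_linear.continuous_on)
next
  case (Suc k)
  obtain D where "\<forall>x\<in>W. (f has_derivative D x) (at x)" "\<forall>v. Ck_on k (\<lambda>x. D x v) W"
    using Suc.prems by auto
  with Suc.IH show ?case
    by (auto intro!: exI[of _ "\<lambda>x v. L (D x v)"] bounded_linear.has_derivative[OF assms])
qed

lemma Ck_on_bounded_linear: "bounded_linear L \<Longrightarrow> Ck_on k L W"
proof (cases k)
  case 0
  assume "bounded_linear L" with 0 show ?thesis by (auto intro: linear_continuous_on)
next
  case (Suc m)
  assume "bounded_linear L" with Suc show ?thesis
    by (auto intro!: exI[of _ "\<lambda>x. L"] bounded_linear_imp_has_derivative Ck_on_const)
qed

lemma Ck_on_scaleR: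
  fixes f :: "'a::euclidean_space \<Rightarrow> real" and g :: "'a \<Rightarrow> 'b::real_normed_vector"
  shows "Ck_on k f W \<Longrightarrow> Ck_on k g W \<Longrightarrow> Ck_on k (\<lambda>x. f x *\<^sub>R g x) W"
proof (induction k arbitrary: f g)
  case (Suc k)
  obtain D E where *: "\<forall>x\<in>W. (f has_derivative D x) (at x)" "\<forall>v. Ck_on k (\<lambda>x. D x v) W"
    "\<forall>x\<in>W. (g has_derivative E x) (at x)" "\<forall>v. Ck_on k (\<lambda>x. E x v) W"
    using Suc.prems by auto
  have "Ck_on k f W" "Ck_on k g W" using Suc.prems Ck_on_Suc_imp by blast+
  with * Suc.IH show ?case
    by (auto intro!: exI[of _ "\<lambda>x v. f x *\<^sub>R E x v + D x v *\<^sub>R g x"] has_derivative_scaleR Ck_on_add)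
qed (auto intro: continuous_on_scaleR)

lemma Ck_on_prod:
  fixes f :: "'i \<Rightarrow> 'a::euclidean_space \<Rightarrow> real"
  shows "(\<And>i. i \<in> I \<Longrightarrow> Ck_on k (f i) W) \<Longrightarrow> Ck_on k (\<lambda>x. \<Prod>i\<in>I. f i x) W"
  by (induction I rule: infinite_finite_induct)
     (auto intro: Ck_on_const Ck_on_scaleR[where 'b = real, unfolded real_scaleR_def])

lemma Ck_on_inverse:
  fixes f :: "'a::euclidean_space \<Rightarrow> real"
  assumes "\<And>x. x \<in> W \<Longrightarrow> f x \<noteq> 0"
  shows "Ck_on k f W \<Longrightarrow> Ck_on k (\<lambda>x. inverse (f x)) W"
proof (induction k)
  case 0
  then show ?case using assms by (auto intro!: continuous_on_inverse)
next
  case (Suc k)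
  obtain D where *: "\<forall>x\<in>W. (f has_derivative D x) (at x)" "\<forall>v. Ck_on k (\<lambda>x. D x v) W"
    using Suc.prems by auto
  have 1: "Ck_on k (\<lambda>x. inverse (f x)) W" using Suc Ck_on_Suc_imp by blast
  have "Ck_on k (\<lambda>x. - (inverse (f x) * D x v * inverse (f x))) W" for v
    using * 1 by (intro Ck_on_bounded_linear_comp[OF bounded_linear_minus[OF bounded_linear_ident]]
        Ck_on_scaleR[where 'b = real, unfolded real_scaleR_def]) auto
  with * assms show ?case
    by (auto intro!: exI[of _ "\<lambda>x v. - (inverse (f x) * D x v * inverse (f x))"]
        Deriv.has_derivative_inverse)
qed

lemma Ck_on_vec:
  fixes f :: "'a::euclidean_space \<Rightarrow> real^'n"
  assumes "\<And>i. Ck_on k (\<lambda>x. f x $ i) W"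
  shows "Ck_on k f W"
proof -
  have "f = (\<lambda>x. \<Sum>i\<in>UNIV. f x $ i *\<^sub>R axis i 1)"
    by (simp add: fun_eq_iff basis_expansion flip: scalar_mult_eq_scaleR)
  moreover have "Ck_on k (\<lambda>x. \<Sum>i\<in>UNIV. f x $ i *\<^sub>R axis i (1::real)) W"
    by (intro Ck_on_sum Ck_on_scaleR assms Ck_on_const)
  ultimately show ?thesis by simp
qed

lemma Ck_on_det:
  fixes A :: "'a::euclidean_space \<Rightarrow> real^'n^'n"
  assumes "\<And>i j. Ck_on k (\<lambda>x. A x $ i $ j) W"
  shows "Ck_on k (\<lambda>x. det (A x)) W"
  unfolding det_def
  by (intro Ck_on_sum Ck_on_scaleR[where 'b = real, unfolded real_scaleR_def] Ck_on_prod assms Ck_on_const)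

text \<open>\<open>Ck_on\<close> speaks of derivatives in fixed directions, but the chain rule evaluates the derivative of
  the outer map in the moving direction \<open>D x v\<close>. Expanding that direction in a basis reduces the step to
  fixed directions with \<open>C\<^sup>k\<close> coefficients.\<close>

lemma Ck_on_compose:
  fixes f :: "'a::euclidean_space \<Rightarrow> 'b::euclidean_space" and g :: "'b \<Rightarrow> 'c::real_normed_vector"
  shows "Ck_on k f W \<Longrightarrow> Ck_on k g W' \<Longrightarrow> f ` W \<subseteq> W' \<Longrightarrow> Ck_on k (\<lambda>x. g (f x)) W"
proof (induction k arbitrary: g)
  case 0
  then show ?case by (auto intro: continuous_on_compose2)
next
  case (Suc k)
  obtain D E where *: "\<forall>x\<in>W. (f has_derivative D x) (at x)" "\<forall>v. Ck_on k (\<lambda>x. D x v) W"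
    "\<forall>x\<in>W'. (g has_derivative E x) (at x)" "\<forall>v. Ck_on k (\<lambda>x. E x v) W'"
    using Suc.prems(1,2) by auto
  have f: "Ck_on k f W" using Suc.prems Ck_on_Suc_imp by blast
  have der: "((\<lambda>x. g (f x)) has_derivative (\<lambda>v. \<Sum>b\<in>Basis. (D x v \<bullet> b) *\<^sub>R E (f x) b)) (at x)"
    if "x \<in> W" for x
  proof -
    have Efx: "(g has_derivative E (f x)) (at (f x))" using * Suc.prems that by blast
    then interpret linear "E (f x)" using has_derivative_linear by blast
    have sumE: "E (f x) y = (\<Sum>b\<in>Basis. (y \<bullet> b) *\<^sub>R E (f x) b)" for y
      by (subst (1) euclidean_representation[of y, symmetric]) (simp add: sum scale)
    have "((\<lambda>x. g (f x)) has_derivative (\<lambda>v. E (f x) (D x v))) (at x)"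
      using has_derivative_compose[of f "D x" x UNIV g "E (f x)"] Efx * that by blast
    then show ?thesis unfolding sumE[of "D x _"] .
  qed
  have "Ck_on k (\<lambda>x. \<Sum>b\<in>Basis. (D x v \<bullet> b) *\<^sub>R E (f x) b) W" for v
    using Suc.prems * f
    by (intro Ck_on_sum Ck_on_scaleR Suc.IH
        Ck_on_bounded_linear_comp[OF bounded_linear_inner_left]) auto
  with der show ?case
    unfolding Ck_on.simps by (intro exI[of _ "\<lambda>x v. \<Sum>b\<in>Basis. (D x v \<bullet> b) *\<^sub>R E (f x) b"]) blast
qed

text \<open>The derivative of the inverse map is the inverse matrix, which by Cramer's rule is a rational
  function of the derivative of the map itself. This feeds one degree of differentiability of the
  inverse into the next one.\<close>

theorem smooth_local_inverse:
  fixes F :: "real^'n \<Rightarrow> real^'n"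
  assumes W: "open W" "x0 \<in> W" and F: "\<And>k. Ck_on k F W"
    and D0: "(F has_derivative D0) (at x0)" and inj: "\<And>v. D0 v = 0 \<Longrightarrow> v = 0"
  obtains X Y G where "open X" "X \<subseteq> W" "x0 \<in> X" "open Y" "F ` X = Y"
    "\<And>k. Ck_on k G Y" "\<And>x. x \<in> X \<Longrightarrow> G (F x) = x"
proof -
  have "Ck_on 1 F W" by (rule F)
  then obtain D where D: "\<And>x. x \<in> W \<Longrightarrow> (F has_derivative D x) (at x)"
    and contD: "\<And>v. continuous_on W (\<lambda>x. D x v)"
    by auto
  have DCk: "Ck_on k (\<lambda>x. D x v) W" for k v
  proof -
    have "Ck_on (Suc k) F W" by (rule F)
    then obtain E where E: "\<And>x. x \<in> W \<Longrightarrow> (F has_derivative E x) (at x)" "Ck_on k (\<lambda>x. E x v) W"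
      by auto
    have "E x = D x" if "x \<in> W" for x
      using has_derivative_unique[OF E(1) D] that by blast
    then show ?thesis using Ck_on_cong[OF W(1) _ E(2)] by simp
  qed
  define f' where "f' x = Blinfun (D x)" for x
  have f': "blinfun_apply (f' x) = D x" if "x \<in> W" for x
    using D[OF that] by (simp add: f'_def bounded_linear_Blinfun_apply has_derivative_bounded_linear)
  have "linear (D x0)" using D W has_derivative_linear by blast
  moreover have "D x0 = D0" using D W D0 has_derivative_unique by blast
  ultimately have "linear D0" "inj D0" using inj linear_injective_0 by blast+
  then obtain L where L: "linear L" "L \<circ> D0 = id"
    using linear_injective_left_inverse by blast
  have invf: "Blinfun L o\<^sub>L f' x0 = id_blinfun"
    using L f'[OF W(2)] \<open>D x0 = D0\<close>
    by (intro blinfun_eqI) (simp add: bounded_linear_Blinfun_apply linear_linear[symmetric] fun_eq_iff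
        linear_conv_bounded_linear)
  have "continuous_on W f'"
    by (intro continuous_on_blinfun_componentwise continuous_on_eq[OF contD]) (simp add: f')
  with inverse_function_theorem[of W F f' x0 "Blinfun L"] W D f' invf
  obtain X Y G G' where XY: "open X" "X \<subseteq> W" "x0 \<in> X" "open Y" "homeomorphism X Y F G"
    and G: "\<And>y. y \<in> Y \<Longrightarrow> (G has_derivative (G' y)) (at y)"
    and G': "\<And>y. y \<in> Y \<Longrightarrow> G' y = inv (blinfun_apply (f' (G y)))"
    and bij: "\<And>y. y \<in> Y \<Longrightarrow> bij (blinfun_apply (f' (G y)))"
    by (smt (verit, ccfv_threshold))
  have GY: "G ` Y = X" and GX: "y \<in> Y \<Longrightarrow> G y \<in> W" for y
    using XY by (auto simp: homeomorphism_def)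
  define A where "A y = matrix (D (G y))" for y
  have lin: "linear (D (G y))" if "y \<in> Y" for y
    using D GX has_derivative_linear that by blast
  have det: "det (A y) \<noteq> 0" if "y \<in> Y" for y
    using bij[OF that] f'[OF GX[OF that]] lin[OF that]
    by (simp add: A_def bij_is_inj det_nz_iff_inj)
  have cramer': "G' y v $ m = det (\<chi> i j. if j = m then v $ i else A y $ i $ j) * inverse (det (A y))"
    if "y \<in> Y" for y v m
  proof -
    have "D (G y) (G' y v) = v"
      using G'[OF that] bij[OF that] f'[OF GX[OF that]] by (simp add: bij_is_surj surj_f_inv_f)
    then have "A y *v G' y v = v" by (simp add: A_def matrix_works lin that)
    then have "G' y v = (\<chi> k. det (\<chi> i j. if j = k then v $ i else A y $ i $ j) / det (A y))"
      using cramer[OF det[OF that]] by blast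
    then show ?thesis by (simp add: divide_inverse)
  qed
  have "Ck_on k G Y" for k
  proof (induction k)
    case 0
    then show ?case using XY by (auto simp: homeomorphism_def)
  next
    case (Suc k)
    have "Ck_on k (\<lambda>y. A y $ i $ j) Y" for i j
    proof -
      have "Ck_on k (\<lambda>y. D (G y) (axis j 1) $ i) Y"
        by (rule Ck_on_bounded_linear_comp[OF bounded_linear_vec_nth])
           (rule Ck_on_compose[OF Suc DCk], use GX in blast)
      then show ?thesis by (simp add: A_def matrix_def)
    qed
    note A = this
    have "Ck_on k (\<lambda>y. if j = m then v $ i else A y $ i $ j) Y" for v m i j
      using A Ck_on_const by (cases "j = m") auto
    then have "Ck_on k (\<lambda>y. det (\<chi> i j. if j = m then v $ i else A y $ i $ j) * inverse (det (A y))) Y"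
      for v m
      by (intro Ck_on_scaleR[where 'b = real, unfolded real_scaleR_def] Ck_on_inverse Ck_on_det det A)
         simp
    then have "Ck_on k (\<lambda>y. G' y v) Y" for v
      by (intro Ck_on_vec) (rule Ck_on_cong[OF XY(4) cramer'[symmetric]])
    with G show ?case by auto
  qed
  moreover have "F ` X = Y" "\<And>x. x \<in> X \<Longrightarrow> G (F x) = x"
    using XY by (auto simp: homeomorphism_def)
  ultimately show ?thesis using that XY by blast
qed

section \<open>Derivatives within convex sets with interior\<close>

text \<open>Such sets carry a unique derivative at each of their points, the boundary included. The
  standard simplex and the orthant are the two instances of interest.\<close>

definition solid_convex :: "'a::euclidean_space set \<Rightarrow> bool" where
  "solid_convex C \<longleftrightarrow> convex C \<and> interior C \<noteq> {}"

text \<open>The derivative is determined along every segment from \<open>x\<close> into \<open>C\<close>, and the directions of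
  these segments contain an open set, hence span. The coordinate axes need not be among them: at a
  vertex of the standard simplex other than the origin, the axes of the other vertices leave it both ways.\<close>

lemma has_derivative_unique_solid_convex:
  fixes f :: "'a::euclidean_space \<Rightarrow> 'b::real_normed_vector"
  assumes C: "solid_convex C" and x: "x \<in> C"
    and D: "(f has_derivative D1) (at x within C)" "(f has_derivative D2) (at x within C)"
  shows "D1 = D2"
proof -
  define E where "E v = D1 v - D2 v" for v
  have E: "((\<lambda>y. 0) has_derivative E) (at x within C)"
    using has_derivative_diff[OF D] by (simp add: E_def[abs_def])
  then interpret E: linear E using has_derivative_linear by blast
  have seg: "E (y - x) = 0" if "y \<in> C" for y
  proof -
    have "(\<lambda>t. x + t *\<^sub>R (y - x)) ` {0..1::real} \<subseteq> C"
      using C x that by (auto simp: solid_convex_def algebra_simps convex_alt)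
    then have "((\<lambda>y. 0) has_derivative E) (at (x + 0 *\<^sub>R (y - x)) within (\<lambda>t. x + t *\<^sub>R (y - x)) ` {0..1::real})"
      using E has_derivative_subset by auto
    moreover have "((\<lambda>t. x + t *\<^sub>R (y - x)) has_derivative (\<lambda>t. t *\<^sub>R (y - x))) (at 0 within {0..1::real})"
      by (auto intro!: derivative_eq_intros)
    ultimately have "((\<lambda>t. 0) has_derivative (\<lambda>t. E (t *\<^sub>R (y - x)))) (at 0 within {0..1::real})"
      by (rule has_derivative_in_compose[rotated])
    then have "((\<lambda>t. 0) has_vector_derivative E (y - x)) (at 0 within cbox 0 (1::real))"
      by (simp add: has_vector_derivative_def E.scale)
    moreover have "((\<lambda>t. 0) has_vector_derivative (0::'b)) (at 0 within cbox 0 (1::real))"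
      by (rule has_vector_derivative_const)
    ultimately show ?thesis
      by (intro vector_derivative_unique_within_closed_interval[of 0 1 0]) auto
  qed
  obtain y e where ye: "e > 0" "ball y e \<subseteq> C"
    using C open_contains_ball[of "interior C"] interior_subset[of C] unfolding solid_convex_def by fastforce
  have "E v = 0" for v
  proof (cases "v = 0")
    case False
    define r where "r = e / (2 * norm v)"
    have r: "r > 0" and "norm (r *\<^sub>R v) < e" using ye False by (auto simp: r_def)
    then have "y + r *\<^sub>R v \<in> C" "y \<in> C" using ye by (auto simp: subset_iff dist_norm)
    then have "E (y + r *\<^sub>R v - x) - E (y - x) = 0" using seg by simp
    then have "r *\<^sub>R E v = 0" by (simp add: E.diff[symmetric] E.scale[symmetric])
    then show ?thesis using r by simp
  qed (simp add: E.zero)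
  then show ?thesis by (auto simp: E_def)
qed

lemma at_within_openin:
  assumes "openin (top_of_set C) A" "x \<in> A"
  shows "at x within A = at x within C"
proof -
  obtain Q where "open Q" "A = C \<inter> Q" using assms(1) by (auto simp: openin_open)
  then show ?thesis using assms(2) at_within_nhd[of x Q A C] by blast
qed

lemma deriv_within_eqI:
  assumes "solid_convex C" "openin (top_of_set C) A" "x \<in> A" "(f has_derivative D) (at x within A)"
  shows "deriv_within A f x = D"
proof -
  have "(f has_derivative deriv_within A f x) (at x within A)"
    using assms(4) by (metis differentiableI frechet_derivative_works)
  then show ?thesis
    using assms has_derivative_unique_solid_convex[OF assms(1), of x f] at_within_openin[OF assms(2,3)]
      openin_imp_subset[OF assms(2)] by auto
qed

lemma smooth_on_setE:
  assumes "smooth_on_set A f" "x \<in> A"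
  obtains W F where "open W" "x \<in> W" "\<And>k. Ck_on k F W" "\<And>y. y \<in> A \<Longrightarrow> y \<in> W \<Longrightarrow> F y = f y"
proof -
  have "\<exists>W F. open W \<and> x \<in> W \<and> (\<forall>k. Ck_on k F W) \<and> (\<forall>y\<in>A \<inter> W. F y = f y)"
    using assms unfolding smooth_on_set_def by (rule bspec)
  then show ?thesis using that by auto
qed

lemma smooth_on_setI:
  assumes "\<And>x. x \<in> A \<Longrightarrow> \<exists>W F. open W \<and> x \<in> W \<and> (\<forall>k. Ck_on k F W) \<and> (\<forall>y\<in>A \<inter> W. F y = f y)"
  shows "smooth_on_set A f"
  using assms unfolding smooth_on_set_def by (rule ballI)

lemma smooth_on_set_local_derivative:
  assumes "smooth_on_set A f" "x \<in> A"
  obtains W D where "open W" "x \<in> W" "\<And>y. y \<in> A \<inter> W \<Longrightarrow> (f has_derivative D y) (at y within A)"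
    "\<And>v. continuous_on W (\<lambda>y. D y v)"
proof -
  obtain W F where W: "open W" "x \<in> W" "\<And>k. Ck_on k F W" "\<And>y. y \<in> A \<Longrightarrow> y \<in> W \<Longrightarrow> F y = f y"
    by (rule smooth_on_setE[OF assms]) (rule that)
  have "Ck_on 1 F W" by (rule W)
  then obtain D where D: "\<And>y. y \<in> W \<Longrightarrow> (F has_derivative D y) (at y)"
    "\<And>v. continuous_on W (\<lambda>y. D y v)" by auto
  have der: "(f has_derivative D y) (at y within A)" if y: "y \<in> A \<inter> W" for y
  proof -
    obtain d where d: "d > 0" "ball y d \<subseteq> W" using W(1) y open_contains_ball by blast
    have "(F has_derivative D y) (at y within A)" using D(1) y has_derivative_at_withinI by blast
    then show ?thesis
      by (rule has_derivative_transform_within[OF _ d(1)])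
         (use y d W(4) in \<open>auto simp: subset_iff dist_commute\<close>)
  qed
  show ?thesis by (rule that[OF W(1,2) der D(2)])
qed

lemma smooth_on_set_has_derivative:
  assumes "smooth_on_set A f" "x \<in> A"
  shows "(f has_derivative deriv_within A f x) (at x within A)"
proof -
  obtain W D where "open W" "x \<in> W" "\<And>y. y \<in> A \<inter> W \<Longrightarrow> (f has_derivative D y) (at y within A)"
    "\<And>v. continuous_on W (\<lambda>y. D y v)"
    by (rule smooth_on_set_local_derivative[OF assms]) (rule that)
  then have "f differentiable (at x within A)" using assms(2) unfolding differentiable_def by blast
  then show ?thesis by (simp add: frechet_derivative_works)
qed

lemma smooth_on_set_imp_continuous_on: "smooth_on_set A f \<Longrightarrow> continuous_on A f"
  by (rule has_derivative_continuous_on) (rule smooth_on_set_has_derivative)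

lemma smooth_on_set_imp_differentiable_on: "smooth_on_set A f \<Longrightarrow> f differentiable_on A"
  unfolding differentiable_on_def
  by (intro ballI differentiableI) (rule smooth_on_set_has_derivative)

lemma continuous_on_deriv_within:
  assumes C: "solid_convex C" "openin (top_of_set C) A" and f: "smooth_on_set A f"
  shows "continuous_on A (\<lambda>x. deriv_within A f x v)"
proof (unfold continuous_on_eq_continuous_within, intro ballI)
  fix x assume x: "x \<in> A"
  obtain W D where W: "open W" "x \<in> W" "\<And>y. y \<in> A \<inter> W \<Longrightarrow> (f has_derivative D y) (at y within A)"
    "\<And>v. continuous_on W (\<lambda>y. D y v)"
    by (rule smooth_on_set_local_derivative[OF f x]) (rule that)
  obtain d where d: "d > 0" "ball x d \<subseteq> W" using W open_contains_ball by blast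
  have "continuous (at x within A) (\<lambda>y. D y v)"
    using W by (simp add: continuous_on_eq_continuous_at continuous_at_imp_continuous_at_within)
  then show "continuous (at x within A) (\<lambda>x. deriv_within A f x v)"
  proof (rule continuous_transform_within[OF _ d(1) x])
    fix y assume "y \<in> A" "dist y x < d"
    then have "y \<in> A \<inter> W" using d by (auto simp: subset_iff dist_commute)
    then show "D y v = deriv_within A f y v"
      using deriv_within_eqI[OF C _ W(3)] by auto
  qed
qed

lemma solid_convex_orthant: "solid_convex (orthant :: (real^'n) set)"
  unfolding solid_convex_def
proof
  show "convex (orthant :: (real^'n) set)" by (auto simp: orthant_def convex_def)
  have "open (\<Inter>i. {x::real^'n. 0 < x $ i})" by (intro open_INT ballI open_halfspace_component_gt_cart) auto
  moreover have "(\<Inter>i. {x::real^'n. 0 < x $ i}) \<subseteq> orthant" by (auto simp: orthant_def less_imp_le)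
  moreover have "(\<chi> i. 1) \<in> (\<Inter>i. {x::real^'n. 0 < x $ i})" by simp
  ultimately show "interior (orthant :: (real^'n) set) \<noteq> {}" using interiorI by (metis empty_iff)
qed

lemma mem_std_simplex_UNIV:
  "x \<in> std_simplex UNIV \<longleftrightarrow> (\<forall>i. 0 \<le> x $ i) \<and> (\<Sum>i\<in>UNIV. x $ i) \<le> 1"
proof -
  have "x $ i \<le> 1" if "\<forall>i. 0 \<le> x $ i" "(\<Sum>i\<in>UNIV. x $ i) \<le> 1" for i
    using member_le_sum[of i UNIV "\<lambda>i. x $ i"] that by auto
  then show ?thesis by (auto simp: std_simplex_def coord_space_def)
qed

lemma solid_convex_std_simplex: "solid_convex (std_simplex UNIV :: (real^'n::finite) set)"
  unfolding solid_convex_def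
proof
  show "convex (std_simplex UNIV :: (real^'n) set)"
  proof (rule convexI)
    fix x y :: "real^'n" and u v :: real
    assume x: "x \<in> std_simplex UNIV" and y: "y \<in> std_simplex UNIV" and uv: "0 \<le> u" "0 \<le> v" "u + v = 1"
    have "(\<Sum>i\<in>UNIV. (u *\<^sub>R x + v *\<^sub>R y) $ i) = u * (\<Sum>i\<in>UNIV. x $ i) + v * (\<Sum>i\<in>UNIV. y $ i)"
      by (simp add: sum.distrib sum_distrib_left)
    also have "\<dots> \<le> u * 1 + v * 1"
      using x y uv by (intro add_mono mult_left_mono) (auto simp: mem_std_simplex_UNIV)
    finally show "u *\<^sub>R x + v *\<^sub>R y \<in> std_simplex UNIV"
      using x y uv by (auto simp: mem_std_simplex_UNIV)
  qed
  define Q where "Q = (\<Inter>i. {x::real^'n. 0 < x $ i}) \<inter> {x. (\<Sum>i\<in>UNIV. x $ i) < 1}"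
  have "open Q" unfolding Q_def
    by (intro open_Int open_INT ballI open_halfspace_component_gt_cart open_Collect_less continuous_intros) auto
  moreover have "Q \<subseteq> std_simplex UNIV" by (auto simp: Q_def mem_std_simplex_UNIV less_imp_le)
  moreover have "(\<chi> i. 1 / (2 * real CARD('n))) \<in> Q" by (simp add: Q_def)
  ultimately show "interior (std_simplex UNIV :: (real^'n) set) \<noteq> {}" using interiorI by (metis empty_iff)
qed

section \<open>Charts and the chain rule\<close>

locale cornered_manifold =
  fixes M :: "('m, 'n::finite) mfd"
  assumes mwc: "manifold_with_corners M"
begin

lemma chart_properties:
  assumes "(W, c) \<in> atlas M"
  shows chart_openin: "openin (mtop M) W"
    and chart_image_openin_orthant: "openin (top_of_set orthant) (c ` W)"
    and chart_homeo: "homeomorphic_map (subtopology (mtop M) W) (top_of_set (c ` W)) c"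
proof -
  have "\<forall>(U, c)\<in>atlas M. openin (mtop M) U \<and> openin (top_of_set orthant) (c ` U) \<and>
        homeomorphic_map (subtopology (mtop M) U) (top_of_set (c ` U)) c"
    using mwc unfolding manifold_with_corners_def by (elim conjE)
  from bspec[OF this assms] show "openin (mtop M) W" "openin (top_of_set orthant) (c ` W)"
    "homeomorphic_map (subtopology (mtop M) W) (top_of_set (c ` W)) c" by auto
qed

lemma smooth_transition:
  assumes "(W, c) \<in> atlas M" "(V, d) \<in> atlas M"
  shows "smooth_on_set (c ` (W \<inter> V)) (d \<circ> inv_into W c)"
proof -
  have "\<forall>(U, c)\<in>atlas M. \<forall>(V, d)\<in>atlas M. smooth_on_set (c ` (U \<inter> V)) (d \<circ> inv_into U c)"
    using mwc unfolding manifold_with_corners_def by (elim conjE)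
  from bspec[OF this assms(1)] show ?thesis using assms(2) by auto
qed

lemma smooth_into_chart:
  assumes "smooth_into M C F" "(W, c) \<in> atlas M"
  shows "smooth_on_set (C \<inter> F -` W) (c \<circ> F)"
  using bspec[OF conjunct2[OF assms(1)[unfolded smooth_into_def]] assms(2)] by simp

lemma smooth_into_continuous: "smooth_into M C F \<Longrightarrow> continuous_map (top_of_set C) (mtop M) F"
  unfolding smooth_into_def by (rule conjunct1)

lemma topspace_chart: "(W, c) \<in> atlas M \<Longrightarrow> topspace (subtopology (mtop M) W) = W"
  by (rule topspace_subtopology_subset[OF openin_subset[OF chart_openin]])

lemma chart_inj: "(W, c) \<in> atlas M \<Longrightarrow> inj_on c W"
  using homeomorphic_imp_injective_map[OF chart_homeo] topspace_chart by metis

lemma chart_inv: "(W, c) \<in> atlas M \<Longrightarrow> p \<in> W \<Longrightarrow> inv_into W c (c p) = p"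
  by (rule inv_into_f_f[OF chart_inj])

lemma chart_ex:
  assumes "p \<in> topspace (mtop M)"
  obtains W c where "(W, c) \<in> atlas M" "p \<in> W"
proof -
  have "(\<Union>(U, c)\<in>atlas M. U) = topspace (mtop M)"
    using mwc unfolding manifold_with_corners_def by (elim conjE)
  then have "p \<in> (\<Union>(U, c)\<in>atlas M. U)" using assms by simp
  then show ?thesis using that by auto
qed

lemma chart_image_openin:
  assumes a: "(W, c) \<in> atlas M" and Q: "openin (mtop M) Q"
  shows "openin (top_of_set orthant) (c ` (W \<inter> Q))"
proof -
  have "openin (subtopology (mtop M) W) (W \<inter> Q)" using Q by (simp add: openin_subtopology_Int2)
  then have "openin (top_of_set (c ` W)) (c ` (W \<inter> Q))"
    using homeomorphic_map_openness[OF chart_homeo[OF a], of "W \<inter> Q"] topspace_chart[OF a] by (metis Int_lower1)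
  then show ?thesis using openin_trans chart_image_openin_orthant[OF a] by blast
qed

lemma at_within_chart:
  assumes "(W, c) \<in> atlas M" "openin (mtop M) Q" "p \<in> W \<inter> Q"
  shows "at (c p) within c ` (W \<inter> Q) = at (c p) within orthant"
  using at_within_openin[OF chart_image_openin[OF assms(1,2)]] assms(3) by blast

lemma chart_preimage_openin:
  assumes a: "(W, c) \<in> atlas M" and "open X"
  shows "openin (mtop M) {p \<in> W. c p \<in> X}"
proof -
  have "continuous_map (subtopology (mtop M) W) euclidean c"
    using chart_homeo[OF a] by (simp add: homeomorphic_eq_everything_map continuous_map_in_subtopology)
  then have "openin (subtopology (mtop M) W) {p \<in> topspace (subtopology (mtop M) W). c p \<in> X}"
    using \<open>open X\<close> openin_continuous_map_preimage by (metis open_openin)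
  then show ?thesis
    using openin_trans_full[OF _ chart_openin[OF a]] unfolding topspace_chart[OF a] by blast
qed

lemma transition_has_derivative:
  assumes a: "(W, c) \<in> atlas M" and b: "(V, d) \<in> atlas M" and p: "p \<in> W \<inter> V"
  shows "((d \<circ> inv_into W c) has_derivative transition_deriv (W, c) (V, d) p) (at (c p) within orthant)"
proof -
  have *: "((d \<circ> inv_into W c) has_derivative deriv_within (c ` (W \<inter> V)) (d \<circ> inv_into W c) (c p))
      (at (c p) within c ` (W \<inter> V))"
    using p by (intro smooth_on_set_has_derivative smooth_transition a b) auto
  have "at (c p) within c ` W = at (c p) within orthant"
    using at_within_chart[OF a chart_openin[OF a], of p] p by simp
  with * show ?thesis
    using at_within_chart[OF a chart_openin[OF b] p] by (simp add: transition_deriv_def)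
qed

lemma preimage_openin:
  assumes "continuous_map (top_of_set C) (mtop M) F" "openin (mtop M) Q"
  shows "openin (top_of_set C) (C \<inter> F -` Q)"
  using openin_continuous_map_preimage[OF assms] by (simp add: vimage_def Int_def)

text \<open>The chain rule for \<open>\<psi> \<circ> F\<close>, where the derivative of \<open>\<psi>\<close> is taken in a chart. It is stated within the
  orthant, because at a point of a chart domain the derivative within every relatively open chart
  image is the derivative within the orthant.\<close>

lemma has_derivative_through_chart:
  assumes F: "continuous_map (top_of_set C) (mtop M) F" and x: "x \<in> C" "F x \<in> W"
    and a: "(W, c) \<in> atlas M"
    and A: "((c \<circ> F) has_derivative A) (at x within C)"
    and D: "((\<psi> \<circ> inv_into W c) has_derivative D) (at (c (F x)) within orthant)"
  shows "((\<psi> \<circ> F) has_derivative (\<lambda>v. D (A v))) (at x within C)"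
proof -
  define B where "B = C \<inter> F -` W"
  have B: "openin (top_of_set C) B" unfolding B_def by (rule preimage_openin[OF F chart_openin[OF a]])
  have xB: "x \<in> B" using x by (simp add: B_def)
  have at: "at x within B = at x within C" using at_within_openin[OF B xB] .
  have "c ` (W \<inter> W) \<subseteq> orthant"
    using openin_imp_subset[OF chart_image_openin[OF a chart_openin[OF a]]] .
  then have "(c \<circ> F) ` B \<subseteq> orthant" by (auto simp: B_def)
  then have "((\<psi> \<circ> inv_into W c) has_derivative D) (at ((c \<circ> F) x) within (c \<circ> F) ` B)"
    using D has_derivative_subset by auto
  then have "((\<lambda>y. (\<psi> \<circ> inv_into W c) ((c \<circ> F) y)) has_derivative (\<lambda>v. D (A v))) (at x within B)"
    using has_derivative_in_compose[of "c \<circ> F" A x B "\<psi> \<circ> inv_into W c" D] A by (simp add: at)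
  then have "((\<psi> \<circ> F) has_derivative (\<lambda>v. D (A v))) (at x within B)"
    by (rule has_derivative_transform[OF xB, rotated]) (auto simp: B_def chart_inv[OF a])
  then show ?thesis by (simp add: at)
qed

lemma smooth_into_has_derivative:
  assumes F: "smooth_into M C F" and a: "(W, c) \<in> atlas M" and x: "x \<in> C" "F x \<in> W"
  shows "((c \<circ> F) has_derivative deriv_within C (c \<circ> F) x) (at x within C)"
proof -
  have B: "openin (top_of_set C) (C \<inter> F -` W)" "x \<in> C \<inter> F -` W"
    using preimage_openin[OF smooth_into_continuous[OF F] chart_openin[OF a]] x by auto
  from smooth_on_set_has_derivative[OF smooth_into_chart[OF F a] B(2)] show ?thesis
    unfolding at_within_openin[OF B] .
qed

lemma smooth_into_transition:
  assumes C: "solid_convex C" and F: "smooth_into M C F" and x: "x \<in> C" "F x \<in> W \<inter> V"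
    and a: "(W, c) \<in> atlas M" and b: "(V, d) \<in> atlas M"
  shows "deriv_within C (d \<circ> F) x v = transition_deriv (W, c) (V, d) (F x) (deriv_within C (c \<circ> F) x v)"
proof -
  note smooth_into_continuous[OF F]
  then have "((d \<circ> F) has_derivative (\<lambda>v. transition_deriv (W, c) (V, d) (F x) (deriv_within C (c \<circ> F) x v)))
      (at x within C)"
    by (rule has_derivative_through_chart[OF _ x(1) _ a])
       (use x a b smooth_into_has_derivative[OF F a] transition_has_derivative in auto)
  from deriv_within_eqI[OF C openin_subtopology_self x(1) this] show ?thesis by simp
qed

lemma tangent_space_transition:
  assumes "X \<in> tangent_space M p" "a \<in> atlas M" "b \<in> atlas M" "p \<in> fst a \<inter> fst b"
  shows "X b = transition_deriv a b p (X a)"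
  using assms unfolding tangent_space_def mem_Collect_eq by (elim conjE) blast

lemma tangent_space_eq_0:
  assumes "X \<in> tangent_space M p" "a \<notin> atlas M \<or> p \<notin> fst a"
  shows "X a = 0"
  using assms unfolding tangent_space_def mem_Collect_eq by (elim conjE) blast

lemma differential_in_tangent_space:
  assumes C: "solid_convex C" and F: "smooth_into M C F" and x: "x \<in> C"
  shows "differential M C F x v \<in> tangent_space M (F x)"
  unfolding tangent_space_def mem_Collect_eq
proof (intro conjI allI ballI impI)
  fix a :: "('m, 'n) chart" assume "a \<notin> atlas M \<or> F x \<notin> fst a"
  then show "differential M C F x v a = 0" unfolding differential_def by (intro if_not_P) blast
next
  fix a b :: "('m, 'n) chart"
  assume ab: "a \<in> atlas M" "b \<in> atlas M" "F x \<in> fst a \<inter> fst b"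
  have "deriv_within C (snd b \<circ> F) x v = transition_deriv a b (F x) (deriv_within C (snd a \<circ> F) x v)"
    using smooth_into_transition[OF C F x, of "fst a" "fst b" "snd a" "snd b" v] ab
    unfolding prod.collapse by blast
  then show "differential M C F x v b = transition_deriv a b (F x) (differential M C F x v a)"
    using ab unfolding differential_def by (simp only: Int_iff simp_thms if_True)
qed

text \<open>The transition law is linear, so vanishing coordinates in one chart vanish in all of them.\<close>

lemma tangent_vector_eq_0:
  assumes X: "X \<in> tangent_space M p" and a: "(W, c) \<in> atlas M" "p \<in> W" and "X (W, c) = 0"
  shows "X = (\<lambda>_. 0)"
proof
  fix b :: "('m, 'n) chart"
  obtain V d where b: "b = (V, d)" by fastforce
  show "X b = 0"
  proof (cases "b \<in> atlas M \<and> p \<in> V")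
    case True
    then have "linear (transition_deriv (W, c) b p)"
      using transition_has_derivative[OF a(1), of V d p] a has_derivative_linear b by blast
    moreover have "X b = transition_deriv (W, c) b p (X (W, c))"
      by (rule tangent_space_transition[OF X]) (use True a b in auto)
    ultimately show ?thesis using assms(4) linear_0 by metis
  next
    case False
    then show ?thesis using tangent_space_eq_0[OF X] b by simp
  qed
qed

text \<open>The dimensions of the parameter domain and of the manifold agree, so an immersion has full rank
  and its differential is onto.\<close>

lemma differential_inv:
  assumes C: "solid_convex C" and F: "smooth_into M C F" and x: "x \<in> C"
    and inj: "\<And>v. differential M C F x v = (\<lambda>_. 0) \<Longrightarrow> v = 0"
    and X: "X \<in> tangent_space M (F x)"
  shows "differential M C F x (inv (differential M C F x) X) = X"
proof -
  have "F x \<in> topspace (mtop M)"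
    using smooth_into_continuous[OF F] x by (auto simp: continuous_map_def Pi_iff)
  then obtain W c where a: "(W, c) \<in> atlas M" "F x \<in> W" by (rule chart_ex)
  define A where "A = deriv_within C (c \<circ> F) x"
  have A: "linear A" unfolding A_def
    using smooth_into_has_derivative[OF F a(1) x a(2)] has_derivative_linear by blast
  have dA: "differential M C F x v (W, c) = A v" for v using a by (simp add: differential_def A_def)
  have "v = 0" if "A v = 0" for v
    using inj tangent_vector_eq_0[OF differential_in_tangent_space[OF C F x] a] that dA by metis
  then have "inj A" using A linear_injective_0 by blast
  then have "surj A" using A linear_injective_imp_surjective by blast
  then obtain v where v: "A v = X (W, c)" by (metis surjD)
  have "differential M C F x v = X"
  proof
    fix b :: "('m, 'n) chart"
    obtain V d where b: "b = (V, d)" by fastforce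
    show "differential M C F x v b = X b"
    proof (cases "b \<in> atlas M \<and> F x \<in> V")
      case True
      then have "X b = transition_deriv (W, c) b (F x) (X (W, c))"
        by (intro tangent_space_transition[OF X]) (use a b in auto)
      also have "\<dots> = transition_deriv (W, c) (V, d) (F x) (A v)" by (simp only: b v)
      also have "\<dots> = deriv_within C (d \<circ> F) x v"
        unfolding A_def by (rule smooth_into_transition[OF C F x, symmetric]) (use True a b in auto)
      also have "\<dots> = differential M C F x v b" using True b by (simp add: differential_def)
      finally show ?thesis ..
    next
      case False
      then have "differential M C F x v b = 0" by (auto simp: differential_def b)
      moreover have "X b = 0" using False b by (intro tangent_space_eq_0[OF X]) auto
      ultimately show ?thesis by simp
    qed
  qed
  then show ?thesis by (metis (mono_tags) f_inv_into_f rangeI)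
qed

end


section \<open>Embeddings in coordinates\<close>

text \<open>If finitely many linear functionals separate points, then so does their Gram map
  \<open>v \<mapsto> \<Sum>j. D j v *\<^sub>R \<nabla>(D j)\<close>, because its pairing with \<open>v\<close> is \<open>\<Sum>j. (D j v)\<^sup>2\<close>. It serves as a
  projection from \<open>\<real>\<^sup>K\<close> to \<open>\<real>\<^sup>n\<close> adapted to an immersion.\<close>

lemma gram_map_injective:
  fixes D :: "nat \<Rightarrow> 'a::euclidean_space \<Rightarrow> real"
  assumes lin: "\<And>j. j < K \<Longrightarrow> linear (D j)"
    and inj: "\<And>v. (\<And>j. j < K \<Longrightarrow> D j v = 0) \<Longrightarrow> v = 0"
  obtains a :: "nat \<Rightarrow> 'a" where "\<And>v. (\<Sum>j<K. D j v *\<^sub>R a j) = 0 \<Longrightarrow> v = 0"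
proof -
  define a where "a j = (\<Sum>b\<in>Basis. D j b *\<^sub>R b)" for j
  have "v = 0" if v: "(\<Sum>j<K. D j v *\<^sub>R a j) = 0" for v
  proof -
    have "a j \<bullet> v = D j v" if "j < K" for j
    proof -
      interpret linear "D j" by (rule lin[OF that])
      have "D j v = D j (\<Sum>b\<in>Basis. (v \<bullet> b) *\<^sub>R b)" by (simp add: euclidean_representation)
      also have "\<dots> = (\<Sum>b\<in>Basis. D j b * (b \<bullet> v))" by (simp add: sum scale inner_commute mult.commute)
      also have "\<dots> = a j \<bullet> v" by (simp add: a_def inner_sum_left)
      finally show ?thesis by simp
    qed
    then have "(\<Sum>j<K. (D j v)\<^sup>2) = (\<Sum>j<K. D j v *\<^sub>R a j) \<bullet> v"
      by (simp add: inner_sum_left power2_eq_square)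
    also have "\<dots> = 0" by (simp add: v)
    finally have "\<forall>j<K. D j v = 0" by (simp add: sum_nonneg_eq_0_iff)
    then show "v = 0" using inj by blast
  qed
  then show ?thesis by (rule that[of a])
qed

locale embedded_region = cornered_manifold M for M :: "('m, 'n::finite) mfd" +
  fixes U :: "'m set" and K :: nat and \<phi> :: "'m \<Rightarrow> nat \<Rightarrow> real"
  assumes openU: "openin (mtop M) U" and emb: "smooth_embedding_into M U K \<phi>"
begin

text \<open>At the coordinate vector of a tangent vector \<open>X\<close> at \<open>p\<close>, this is the \<open>j\<close>-th component of the image of
  \<open>X\<close> under the differential of \<open>\<phi>\<close>.\<close>

definition coord_diff :: "('m, 'n) chart \<Rightarrow> 'm \<Rightarrow> nat \<Rightarrow> real^'n \<Rightarrow> real" where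
  "coord_diff a p j = deriv_within (snd a ` (fst a \<inter> U)) (\<lambda>x. \<phi> (inv_into (fst a) (snd a) x) j) (snd a p)"

lemma topspace_U: "topspace (subtopology (mtop M) U) = U"
  by (rule topspace_subtopology_subset[OF openin_subset[OF openU]])

lemma homeo_phi: "homeomorphic_map (subtopology (mtop M) U) (subtopology (Euclidean_space K) (\<phi> ` U)) \<phi>"
  using emb unfolding smooth_embedding_into_def embedding_map_def topspace_U by (rule conjunct1)

lemma inj_phi: "inj_on \<phi> U"
  using homeomorphic_imp_injective_map[OF homeo_phi] unfolding topspace_U .

lemma
  assumes "(W, c) \<in> atlas M"
  shows smooth_phi: "j < K \<Longrightarrow> smooth_on_set (c ` (W \<inter> U)) (\<lambda>x. \<phi> (inv_into W c x) j)"
    and coord_diff_injective: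
      "p \<in> W \<inter> U \<Longrightarrow> (\<And>j. j < K \<Longrightarrow> coord_diff (W, c) p j v = 0) \<Longrightarrow> v = 0"
proof -
  note bspec[OF conjunct2[OF emb[unfolded smooth_embedding_into_def]] assms]
  then have *: "(\<forall>j<K. smooth_on_set (c ` (W \<inter> U)) (\<lambda>x. \<phi> (inv_into W c x) j)) \<and>
    (\<forall>p\<in>W \<inter> U. \<forall>v. (\<forall>j<K. coord_diff (W, c) p j v = 0) \<longrightarrow> v = 0)"
    by (simp only: prod.case coord_diff_def fst_conv snd_conv)
  from conjunct1[OF this] show "j < K \<Longrightarrow> smooth_on_set (c ` (W \<inter> U)) (\<lambda>x. \<phi> (inv_into W c x) j)"
    by blast
  from conjunct2[OF *] show
    "p \<in> W \<inter> U \<Longrightarrow> (\<And>j. j < K \<Longrightarrow> coord_diff (W, c) p j v = 0) \<Longrightarrow> v = 0" by blast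
qed

lemma coord_diff_has_derivative:
  assumes a: "(W, c) \<in> atlas M" and j: "j < K" and p: "p \<in> W \<inter> U"
  shows "(((\<lambda>p. \<phi> p j) \<circ> inv_into W c) has_derivative coord_diff (W, c) p j) (at (c p) within orthant)"
  using smooth_on_set_has_derivative[OF smooth_phi[OF a j], of "c p"] p
  by (simp add: at_within_chart[OF a openU p] coord_diff_def o_def)

lemma linear_coord_diff:
  "(W, c) \<in> atlas M \<Longrightarrow> j < K \<Longrightarrow> p \<in> W \<inter> U \<Longrightarrow> linear (coord_diff (W, c) p j)"
  using coord_diff_has_derivative has_derivative_linear by blast

text \<open>Smoothness provides a neighbourhood for each component; finitely many components share one.\<close>

lemma smooth_extension_phi:
  assumes a: "(W, c) \<in> atlas M" and p: "p \<in> W \<inter> U"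
  obtains W0 F where "open W0" "c p \<in> W0" "\<And>j k. j < K \<Longrightarrow> Ck_on k (F j) W0"
    "\<And>j q. j < K \<Longrightarrow> q \<in> W \<inter> U \<Longrightarrow> c q \<in> W0 \<Longrightarrow> F j (c q) = \<phi> q j"
proof -
  have "\<exists>Wj F. j < K \<longrightarrow> open Wj \<and> c p \<in> Wj \<and> (\<forall>k. Ck_on k F Wj) \<and>
      (\<forall>y\<in>c ` (W \<inter> U) \<inter> Wj. F y = \<phi> (inv_into W c y) j)" for j
  proof (cases "j < K")
    case True
    have "c p \<in> c ` (W \<inter> U)" using p by blast
    from bspec[OF smooth_phi[OF a True, unfolded smooth_on_set_def] this] show ?thesis by blast
  qed simp
  then obtain Wj F where WF: "\<And>j. j < K \<longrightarrow> open (Wj j) \<and> c p \<in> Wj j \<and> (\<forall>k. Ck_on k (F j) (Wj j)) \<and>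
      (\<forall>y\<in>c ` (W \<inter> U) \<inter> Wj j. F j y = \<phi> (inv_into W c y) j)"
    by metis
  show ?thesis
  proof
    show "open (\<Inter>j<K. Wj j)" "c p \<in> (\<Inter>j<K. Wj j)" using WF by auto
    show "Ck_on k (F j) (\<Inter>j<K. Wj j)" if "j < K" for j k
      using WF[of j] that by (auto intro: Ck_on_subset)
    show "F j (c q) = \<phi> q j" if "j < K" "q \<in> W \<inter> U" "c q \<in> (\<Inter>j<K. Wj j)" for j q
      using WF[of j] that chart_inv[OF a, of q] by auto
  qed
qed

end

section \<open>Affine reference maps of a simplex\<close>

lemma Ck_on_affine_component:
  assumes "affine_map_into K ft"
  shows "Ck_on k (\<lambda>z. ft z j) W"
proof -
  have "bounded_linear (\<lambda>v. ft v j - ft 0 j)"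
    using assms linear_conv_bounded_linear unfolding affine_map_into_def by blast
  then have "Ck_on k (\<lambda>v. (ft v j - ft 0 j) + ft 0 j) W"
    by (intro Ck_on_add Ck_on_const Ck_on_bounded_linear)
  then show ?thesis by simp
qed

locale affine_reference_map = embedded_region M U K \<phi>
  for M :: "('m, 'n::finite) mfd" and U K \<phi> +
  fixes T :: "'m set" and ft :: "real^'n \<Rightarrow> nat \<Rightarrow> real"
  assumes T_sub: "T \<subseteq> U" and affine: "affine_map_into K ft" and inj_ft: "inj ft"
    and image_ft: "ft ` std_simplex UNIV = \<phi> ` T"
begin

abbreviation f :: "real^'n \<Rightarrow> 'm" where "f \<equiv> inv_into U \<phi> \<circ> ft"

lemma f_mem: assumes "z \<in> std_simplex UNIV" shows "f z \<in> T" and "\<phi> (f z) = ft z"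
proof -
  have "ft z \<in> \<phi> ` T" using assms image_ft by blast
  then obtain p where p: "p \<in> T" "ft z = \<phi> p" by blast
  then have "f z = p" using inv_into_f_f[OF inj_phi] T_sub by auto
  with p show "f z \<in> T" "\<phi> (f z) = ft z" by auto
qed

lemma f_bij: "bij_betw f (std_simplex UNIV) T"
proof (rule bij_betw_imageI)
  show "inj_on f (std_simplex UNIV)"
    by (rule inj_onI) (metis f_mem(2) injD inj_ft)
  show "f ` std_simplex UNIV = T"
  proof
    show "f ` std_simplex UNIV \<subseteq> T" using f_mem by blast
    show "T \<subseteq> f ` std_simplex UNIV"
    proof
      fix p assume p: "p \<in> T"
      then have "\<phi> p \<in> ft ` std_simplex UNIV" using image_ft by blast
      then obtain z where z: "z \<in> std_simplex UNIV" "ft z = \<phi> p" by force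
      then have "f z = p" using inv_into_f_f[OF inj_phi] T_sub p by auto
      with z show "p \<in> f ` std_simplex UNIV" by blast
    qed
  qed
qed

lemma linear_part: "linear (\<lambda>v. ft v j - ft 0 j)"
  using affine unfolding affine_map_into_def by blast

text \<open>The components of \<open>ft\<close> beyond the \<open>K\<close>-th vanish, so the first \<open>K\<close> of them already separate points.\<close>

lemma linear_part_injective:
  assumes "\<And>j. j < K \<Longrightarrow> ft v j - ft 0 j = 0"
  shows "v = 0"
proof -
  have "ft v j = ft 0 j" for j
  proof (cases "j < K")
    case False
    have "ft v \<in> topspace (Euclidean_space K)" "ft 0 \<in> topspace (Euclidean_space K)"
      using affine unfolding affine_map_into_def by blast+
    then show ?thesis using False by (simp add: topspace_Euclidean_space)
  qed (use assms in simp)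
  then have "ft v = ft 0" by blast
  then show ?thesis using inj_ft injD by metis
qed

lemma f_continuous: "continuous_map (top_of_set (std_simplex UNIV)) (mtop M) f"
proof -
  obtain g where g: "homeomorphic_maps (subtopology (mtop M) U) (subtopology (Euclidean_space K) (\<phi> ` U)) \<phi> g"
    using homeo_phi homeomorphic_map_maps by blast
  have gphi: "g (\<phi> p) = p" if "p \<in> U" for p
    using g that topspace_U by (auto simp: homeomorphic_maps_def)
  have gcont: "continuous_map (subtopology (Euclidean_space K) (\<phi> ` U)) (mtop M) g"
    using g by (auto simp: homeomorphic_maps_def continuous_map_in_subtopology)
  have "continuous_map (top_of_set (std_simplex UNIV)) (powertop_real UNIV) ft"
  proof (subst continuous_map_componentwise_UNIV, intro allI)
    fix j
    have "continuous_on (std_simplex UNIV) (\<lambda>z. ft z j)"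
      using Ck_on_affine_component[OF affine, of 0] by simp
    then show "continuous_map (top_of_set (std_simplex UNIV)) euclideanreal (\<lambda>z. ft z j)" by simp
  qed
  moreover have "ft z \<in> {x. \<forall>i\<ge>K. x i = 0}" for z
    using affine unfolding affine_map_into_def topspace_Euclidean_space by blast
  moreover have "ft z \<in> \<phi> ` U" if "z \<in> std_simplex UNIV" for z
    using f_mem[OF that] T_sub by (metis image_eqI subsetD)
  ultimately have "continuous_map (top_of_set (std_simplex UNIV)) (subtopology (Euclidean_space K) (\<phi> ` U)) ft"
    by (auto simp: Euclidean_space_def continuous_map_in_subtopology)
  then have "continuous_map (top_of_set (std_simplex UNIV)) (mtop M) (g \<circ> ft)"
    using gcont continuous_map_compose by blast
  moreover have "(g \<circ> ft) z = f z" if "z \<in> std_simplex UNIV" for z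
    using f_mem[OF that] gphi T_sub by (metis comp_apply subsetD)
  ultimately show ?thesis by (rule continuous_map_eq) simp
qed

text \<open>Composing \<open>\<phi> \<circ> f = ft\<close> with the Gram map of the differential of \<open>\<phi>\<close> turns the first factor into
  a local diffeomorphism of \<open>\<real>\<^sup>n\<close>, so that \<open>f\<close> is locally an affine map followed by a smooth local
  inverse. The chart values may lie on the boundary of the orthant; the extension of \<open>\<phi>\<close> across the
  boundary is what makes the inverse function theorem applicable there.\<close>

lemma f_smooth_in_chart:
  assumes a: "(W, c) \<in> atlas M"
  shows "smooth_on_set (std_simplex UNIV \<inter> f -` W) (c \<circ> f)"
proof (rule smooth_on_setI)
  fix x assume x: "x \<in> std_simplex UNIV \<inter> f -` W"
  define p where "p = f x"
  have p: "p \<in> W \<inter> U" "\<phi> p = ft x" using x f_mem[of x] T_sub by (auto simp: p_def)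
  obtain W0 F where W0: "open W0" "c p \<in> W0" and F: "\<And>j k. j < K \<Longrightarrow> Ck_on k (F j) W0"
    and Fphi: "\<And>j q. j < K \<Longrightarrow> q \<in> W \<inter> U \<Longrightarrow> c q \<in> W0 \<Longrightarrow> F j (c q) = \<phi> q j"
    by (rule smooth_extension_phi[OF a p(1)]) (rule that)
  have der: "(F j has_derivative coord_diff (W, c) p j) (at (c p))" if j: "j < K" for j
  proof -
    have "Ck_on 1 (F j) W0" by (rule F[OF j])
    then obtain D where D: "(F j has_derivative D) (at (c p))" using W0 by auto
    define A where "A = c ` (W \<inter> U)"
    have A: "openin (top_of_set orthant) A" "c p \<in> A"
      using chart_image_openin[OF a openU] p by (auto simp: A_def)
    obtain d where d: "d > 0" "ball (c p) d \<subseteq> W0" using W0 open_contains_ball by blast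
    have "((\<lambda>x. \<phi> (inv_into W c x) j) has_derivative D) (at (c p) within A)"
    proof (rule has_derivative_transform_within[OF has_derivative_at_withinI[OF D] d(1) A(2)])
      fix y assume "y \<in> A" "dist y (c p) < d"
      then show "F j y = \<phi> (inv_into W c y) j"
        using Fphi[OF j] d chart_inv[OF a] by (auto simp: A_def subset_iff dist_commute)
    qed
    then have "((\<lambda>p. \<phi> p j) \<circ> inv_into W c has_derivative D) (at (c p) within orthant)"
      using at_within_openin[OF A] by (simp add: o_def)
    moreover have "c p \<in> orthant" using A openin_imp_subset by blast
    ultimately have "D = coord_diff (W, c) p j"
      using has_derivative_unique_solid_convex[OF solid_convex_orthant]
        coord_diff_has_derivative[OF a j p(1)] by blast
    with D show ?thesis by simp
  qed
  have inj: "v = 0" if "\<And>j. j < K \<Longrightarrow> coord_diff (W, c) p j v = 0" for v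
    by (rule coord_diff_injective[OF a p(1) that])
  obtain b :: "nat \<Rightarrow> real^'n"
    where b: "\<And>v. (\<Sum>j<K. coord_diff (W, c) p j v *\<^sub>R b j) = 0 \<Longrightarrow> v = 0"
    by (rule gram_map_injective[OF linear_coord_diff[OF a _ p(1)] inj]) (assumption | rule that)+
  define \<Phi> where "\<Phi> y = (\<Sum>j<K. F j y *\<^sub>R b j)" for y
  have "(\<Phi> has_derivative (\<lambda>v. \<Sum>j<K. coord_diff (W, c) p j v *\<^sub>R b j)) (at (c p))"
    unfolding \<Phi>_def[abs_def] by (intro has_derivative_sum has_derivative_scaleR_left der) simp
  moreover have "Ck_on k \<Phi> W0" for k
    unfolding \<Phi>_def[abs_def] by (intro Ck_on_sum Ck_on_scaleR Ck_on_const F) simp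
  ultimately obtain X Y G where X: "open X" "X \<subseteq> W0" "c p \<in> X" and Y: "open Y" "\<Phi> ` X = Y"
    and G: "\<And>k. Ck_on k G Y" "\<And>y. y \<in> X \<Longrightarrow> G (\<Phi> y) = y"
    by - (rule smooth_local_inverse[OF W0 _ _ b]; (assumption | rule that))
  define \<Psi> where "\<Psi> z = (\<Sum>j<K. ft z j *\<^sub>R b j)" for z
  have \<Psi>: "Ck_on k \<Psi> UNIV" for k
    unfolding \<Psi>_def[abs_def] by (intro Ck_on_sum Ck_on_scaleR Ck_on_const Ck_on_affine_component[OF affine])
  have "continuous_on UNIV \<Psi>" using \<Psi>[of 0] by simp
  then have openN: "open (\<Psi> -` Y)" using Y(1) by (simp add: open_vimage)
  have "openin (top_of_set (std_simplex UNIV)) (std_simplex UNIV \<inter> f -` {q \<in> W. c q \<in> X})"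
    by (rule preimage_openin[OF f_continuous chart_preimage_openin[OF a X(1)]])
  then obtain Q where Q: "open Q" "std_simplex UNIV \<inter> f -` {q \<in> W. c q \<in> X} = std_simplex UNIV \<inter> Q"
    by (auto simp: openin_open)
  have \<Phi>\<Psi>: "\<Phi> (c (f z)) = \<Psi> z" "c (f z) \<in> X" if "z \<in> std_simplex UNIV" "z \<in> Q" for z
  proof -
    have fz: "f z \<in> W" "c (f z) \<in> X" using that Q(2) by blast+
    then show "c (f z) \<in> X" by simp
    have "F j (c (f z)) = ft z j" if "j < K" for j
    proof -
      have "F j (c (f z)) = \<phi> (f z) j"
        by (rule Fphi[OF that]) (use fz X(2) f_mem(1)[OF \<open>z \<in> std_simplex UNIV\<close>] T_sub in blast)+
      then show ?thesis using f_mem(2)[OF \<open>z \<in> std_simplex UNIV\<close>] by simp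
    qed
    then show "\<Phi> (c (f z)) = \<Psi> z" unfolding \<Phi>_def \<Psi>_def by (intro sum.cong) auto
  qed
  have xQ: "x \<in> Q" "x \<in> std_simplex UNIV" using x Q(2) X(3) by (auto simp: p_def)
  have "\<Psi> x \<in> Y" using \<Phi>\<Psi>[OF xQ(2,1)] Y(2) by (metis imageI)
  then have "open (\<Psi> -` Y \<inter> Q)" "x \<in> \<Psi> -` Y \<inter> Q" using openN Q(1) xQ(1) by (simp_all add: open_Int)
  moreover have "Ck_on k (\<lambda>z. G (\<Psi> z)) (\<Psi> -` Y \<inter> Q)" for k
    by (rule Ck_on_compose[OF Ck_on_subset[OF \<Psi>] G(1)]) auto
  moreover have "G (\<Psi> z) = (c \<circ> f) z" if "z \<in> (std_simplex UNIV \<inter> f -` W) \<inter> (\<Psi> -` Y \<inter> Q)" for z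
  proof -
    have z: "z \<in> std_simplex UNIV" "z \<in> Q" using that by blast+
    have "G (\<Phi> (c (f z))) = c (f z)" by (rule G(2)[OF \<Phi>\<Psi>(2)[OF z]])
    then show ?thesis unfolding \<Phi>\<Psi>(1)[OF z] by simp
  qed
  ultimately show "\<exists>W' H. open W' \<and> x \<in> W' \<and> (\<forall>k. Ck_on k H W') \<and>
      (\<forall>y\<in>(std_simplex UNIV \<inter> f -` W) \<inter> W'. H y = (c \<circ> f) y)"
    by - (rule exI[of _ "\<Psi> -` Y \<inter> Q"], rule exI[of _ "\<lambda>z. G (\<Psi> z)"],
        intro conjI allI ballI; assumption)
qed

lemma f_smooth_into: "smooth_into M (std_simplex UNIV) f"
  unfolding smooth_into_def using f_continuous f_smooth_in_chart by blast

text \<open>The inverse of \<open>f\<close> is \<open>\<phi>\<close> followed by an affine left inverse of \<open>ft\<close>.\<close>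

lemma f_inv_smooth:
  assumes a: "(W, c) \<in> atlas M"
  shows "smooth_on_set (c ` (T \<inter> W)) (inv_into (std_simplex UNIV) f \<circ> inv_into W c)"
proof (rule smooth_on_setI)
  obtain b :: "nat \<Rightarrow> real^'n" where b: "\<And>v. (\<Sum>j<K. (ft v j - ft 0 j) *\<^sub>R b j) = 0 \<Longrightarrow> v = 0"
    by (rule gram_map_injective[of K "\<lambda>j v. ft v j - ft 0 j", OF linear_part linear_part_injective])
       (assumption | rule that)+
  define B where "B v = (\<Sum>j<K. (ft v j - ft 0 j) *\<^sub>R b j)" for v
  have "linear B" unfolding B_def[abs_def]
    by (intro linear_compose_sum ballI linear_compose[OF linear_part, unfolded o_def]
        linear_scaleR_left)
  moreover have "inj B" using b linear_injective_0[OF \<open>linear B\<close>] by (simp add: B_def)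
  ultimately obtain L where L: "linear L" "L \<circ> B = id" using linear_injective_left_inverse by blast
  fix y assume "y \<in> c ` (T \<inter> W)"
  then obtain p where p: "p \<in> W \<inter> U" "y = c p" using T_sub by blast
  obtain W0 F where W0: "open W0" "c p \<in> W0" and F: "\<And>j k. j < K \<Longrightarrow> Ck_on k (F j) W0"
    and Fphi: "\<And>j q. j < K \<Longrightarrow> q \<in> W \<inter> U \<Longrightarrow> c q \<in> W0 \<Longrightarrow> F j (c q) = \<phi> q j"
    by (rule smooth_extension_phi[OF a p(1)]) (rule that)
  \<comment> \<open>In a smooth extension, \<open>F j y\<close> stands for \<open>\<phi> p j = ft z j\<close>; the offset \<open>ft 0 j\<close> is removed before the
    linear left inverse is applied.\<close>
  define H where "H y = L (\<Sum>j<K. (F j y + - ft 0 j) *\<^sub>R b j)" for y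
  have "Ck_on k H W0" for k
    unfolding H_def[abs_def]
    by (intro Ck_on_bounded_linear_comp[OF L(1)[unfolded linear_conv_bounded_linear]]
        Ck_on_sum Ck_on_scaleR Ck_on_add Ck_on_const F) simp
  moreover have "H u = (inv_into (std_simplex UNIV) f \<circ> inv_into W c) u" if "u \<in> c ` (T \<inter> W) \<inter> W0" for u
  proof -
    obtain q where q: "q \<in> T" "q \<in> W" "u = c q" "c q \<in> W0" using \<open>u \<in> _\<close> by blast
    obtain z where z: "z \<in> std_simplex UNIV" "f z = q"
      using q(1) f_bij by (metis bij_betw_imp_surj_on imageE)
    have inv_q: "inv_into (std_simplex UNIV) f q = z"
      using z f_bij by (metis bij_betw_imp_inj_on inv_into_f_f)
    have "F j u + - ft 0 j = ft z j - ft 0 j" if "j < K" for j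
      using Fphi[OF that, of q] q T_sub f_mem(2)[OF z(1)] z(2) by auto
    then have "H u = L (B z)" unfolding H_def B_def by (intro arg_cong[of _ _ L] sum.cong) auto
    also have "\<dots> = z" using L(2) by (simp add: fun_eq_iff)
    finally show ?thesis using inv_q chart_inv[OF a q(2)] q(3) by simp
  qed
  ultimately show "\<exists>W' H. open W' \<and> y \<in> W' \<and> (\<forall>k. Ck_on k H W') \<and>
      (\<forall>u\<in>c ` (T \<inter> W) \<inter> W'. H u = (inv_into (std_simplex UNIV) f \<circ> inv_into W c) u)"
    using W0 p(2) by (intro exI[of _ W0] exI[of _ H]) blast
qed

lemma f_diffeo: "diffeo_simplex M f T"
  unfolding diffeo_simplex_def using f_bij f_smooth_into f_inv_smooth by blast

text \<open>The differential of \<open>\<phi> \<circ> f = ft\<close> is the linear part of \<open>ft\<close>.\<close>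

lemma coord_diff_of_f:
  assumes a: "(W, c) \<in> atlas M" and x: "x \<in> std_simplex UNIV" "f x \<in> W" and j: "j < K"
  shows "coord_diff (W, c) (f x) j (deriv_within (std_simplex UNIV) (c \<circ> f) x v) = ft v j - ft 0 j"
proof -
  have "f x \<in> W \<inter> U" using x f_mem(1)[OF x(1)] T_sub by blast
  note coord_diff_has_derivative[OF a j this]
  from has_derivative_through_chart[OF f_continuous x a smooth_into_has_derivative[OF f_smooth_into a x] this]
  have D: "(((\<lambda>p. \<phi> p j) \<circ> f) has_derivative
      (\<lambda>v. coord_diff (W, c) (f x) j (deriv_within (std_simplex UNIV) (c \<circ> f) x v))) (at x within std_simplex UNIV)" .
  have "((\<lambda>z. (ft z j - ft 0 j) + ft 0 j) has_derivative (\<lambda>v. (ft v j - ft 0 j) + 0)) (at x within std_simplex UNIV)"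
    by (intro has_derivative_add has_derivative_const bounded_linear_imp_has_derivative
        linear_part[unfolded linear_conv_bounded_linear])
  then have "((\<lambda>z. ft z j) has_derivative (\<lambda>v. ft v j - ft 0 j)) (at x within std_simplex UNIV)"
    by (simp only: diff_add_cancel add_0_right)
  then have "(((\<lambda>p. \<phi> p j) \<circ> f) has_derivative (\<lambda>v. ft v j - ft 0 j)) (at x within std_simplex UNIV)"
    by (rule has_derivative_transform[OF x(1), rotated]) (simp add: f_mem(2)[unfolded comp_apply])
  from has_derivative_unique_solid_convex[OF solid_convex_std_simplex x(1) D this] show ?thesis
    by (rule fun_cong)
qed

lemma deriv_f_in_chart_injective:
  assumes a: "(W, c) \<in> atlas M" and x: "x \<in> std_simplex UNIV" "f x \<in> W"
    and d0: "deriv_within (std_simplex UNIV) (c \<circ> f) x v = 0"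
  shows "v = 0"
proof (rule linear_part_injective)
  fix j assume j: "j < K"
  have "f x \<in> W \<inter> U" using x f_mem(1)[OF x(1)] T_sub by blast
  from linear_0[OF linear_coord_diff[OF a j this]] coord_diff_of_f[OF a x j, of v]
  show "ft v j - ft 0 j = 0" unfolding d0 by metis
qed

lemma f_mem_topspace: "x \<in> std_simplex UNIV \<Longrightarrow> f x \<in> topspace (mtop M)"
  using f_mem(1) T_sub openin_subset[OF openU] by blast

lemma differential_f_injective:
  assumes x: "x \<in> std_simplex UNIV" and 0: "differential M (std_simplex UNIV) f x v = (\<lambda>_. 0)"
  shows "v = 0"
proof -
  obtain W c where a: "(W, c) \<in> atlas M" "f x \<in> W" by (rule chart_ex[OF f_mem_topspace[OF x]])
  have "deriv_within (std_simplex UNIV) (c \<circ> f) x v = differential M (std_simplex UNIV) f x v (W, c)"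
    unfolding differential_def using a by (simp only: fst_conv snd_conv simp_thms if_True)
  then have "deriv_within (std_simplex UNIV) (c \<circ> f) x v = 0" using 0 by metis
  then show ?thesis by (rule deriv_f_in_chart_injective[OF a(1) x a(2)])
qed

text \<open>Writing \<open>X\<close> as the image of \<open>v\<close> under the differential of \<open>f\<close>, the hat metric reads off \<open>v\<close>, and the
  differential of \<open>\<phi>\<close> turns \<open>X\<close> into the linear part of \<open>ft\<close> at \<open>v\<close>. The same \<open>v\<close> serves all charts. This
  describes the hat norm without reference to \<open>f\<close>, so different reference maps can be compared.\<close>

lemma hat_metric_eq:
  assumes p: "p \<in> T" and X: "X \<in> tangent_space M p"
  obtains v where "metric_norm (hat_metric M f) p X = norm v"
    "\<And>W c j. (W, c) \<in> atlas M \<Longrightarrow> p \<in> W \<Longrightarrow> j < K \<Longrightarrow> ft v j - ft 0 j = coord_diff (W, c) p j (X (W, c))"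
proof -
  define x where "x = inv_into (std_simplex UNIV) f p"
  have "p \<in> f ` std_simplex UNIV" using p f_bij by (simp add: bij_betw_def)
  then have x: "x \<in> std_simplex UNIV" "f x = p"
    unfolding x_def by (rule inv_into_into, rule f_inv_into_f)
  define v where "v = inv (differential M (std_simplex UNIV) f x) X"
  have "metric_norm (hat_metric M f) p X = norm v"
    by (simp only: metric_norm_def hat_metric_def Let_def norm_eq_sqrt_inner v_def x_def)
  have dX: "differential M (std_simplex UNIV) f x v = X"
    unfolding v_def
    by (rule differential_inv[OF solid_convex_std_simplex f_smooth_into x(1)])
       (use differential_f_injective[OF x(1)] X x(2) in blast)+
  have "ft v j - ft 0 j = coord_diff (W, c) p j (X (W, c))"
    if a: "(W, c) \<in> atlas M" "p \<in> W" and j: "j < K" for W c j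
  proof -
    have fx: "f x \<in> W" using x(2) a(2) by metis
    have "X (W, c) = differential M (std_simplex UNIV) f x v (W, c)" unfolding dX ..
    also have "\<dots> = deriv_within (std_simplex UNIV) (c \<circ> f) x v"
      unfolding differential_def using a(1) fx by (simp only: fst_conv snd_conv simp_thms if_True)
    finally have X_eq: "X (W, c) = deriv_within (std_simplex UNIV) (c \<circ> f) x v" .
    show ?thesis
      using coord_diff_of_f[OF a(1) x(1) fx j, of v] unfolding X_eq x(2) by (rule sym)
  qed
  with \<open>metric_norm (hat_metric M f) p X = norm v\<close> show ?thesis by (rule that)
qed

end

section \<open>Comparison constants\<close>

lemma null_in_subset: "null_in M N \<Longrightarrow> N' \<subseteq> N \<Longrightarrow> null_in M N'"
  unfolding null_in_def by (fastforce intro: negligible_subset)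

lemma comparison_cong:
  assumes "\<And>p X. p \<in> \<Omega> \<Longrightarrow> X \<in> tangent_space M p \<Longrightarrow> metric_norm g1 p X = metric_norm g1' p X"
    and "\<And>p X. p \<in> \<Omega> \<Longrightarrow> X \<in> tangent_space M p \<Longrightarrow> metric_norm g2 p X = metric_norm g2' p X"
  shows "comparison M g1 g2 \<Omega> = comparison M g1' g2' \<Omega>"
proof -
  have "{p \<in> \<Omega>. \<exists>X\<in>tangent_space M p - {\<lambda>_. 0}. a < ereal (metric_norm g1 p X / metric_norm g2 p X)} =
      {p \<in> \<Omega>. \<exists>X\<in>tangent_space M p - {\<lambda>_. 0}. a < ereal (metric_norm g1' p X / metric_norm g2' p X)}" for a
    using assms by (intro Collect_cong conj_cong bex_cong) auto
  then show ?thesis unfolding comparison_def by simp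
qed

text \<open>On a null set every comparison constant is \<open>-\<infinity>\<close>, so non-negativity needs positive measure.\<close>

lemma comparison_nonneg:
  assumes "\<not> null_in M \<Omega>"
    and "\<And>p. p \<in> \<Omega> \<Longrightarrow> \<exists>X\<in>tangent_space M p - {\<lambda>_. 0}. 0 \<le> metric_norm g1 p X / metric_norm g2 p X"
  shows "0 \<le> comparison M g1 g2 \<Omega>"
  unfolding comparison_def
proof (rule Inf_greatest, rule ccontr)
  fix a
  assume a: "a \<in> {a. null_in M {p \<in> \<Omega>. \<exists>X\<in>tangent_space M p - {\<lambda>_. 0}.
      a < ereal (metric_norm g1 p X / metric_norm g2 p X)}}" and "\<not> 0 \<le> a"
  then have "a < ereal r" if "0 \<le> r" for r
    using that by (metis ereal_less_eq(5) not_le order_less_le_trans)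
  then have "\<Omega> \<subseteq> {p \<in> \<Omega>. \<exists>X\<in>tangent_space M p - {\<lambda>_. 0}.
      a < ereal (metric_norm g1 p X / metric_norm g2 p X)}"
    using assms(2) by blast
  then show False using a null_in_subset assms(1) by blast
qed

text \<open>The infimum that defines the constant of \<open>g0\<close> and \<open>g2\<close> may be \<open>C\<close> without an exceptional null
  set that belongs to \<open>C\<close> itself; passing to \<open>C' > C\<close> supplies one. The quantity \<open>metric_norm g2\<close> may have
  any sign: where the left quotient exceeds the non-negative bound, it is positive.\<close>

lemma comparison_le_mult:
  assumes le: "comparison M g0 g2 \<Omega> \<le> ereal C"
    and g1: "\<And>p X. p \<in> \<Omega> \<Longrightarrow> X \<in> tangent_space M p \<Longrightarrow> 0 \<le> metric_norm g1 p X"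
    and g10: "\<And>p X. p \<in> \<Omega> \<Longrightarrow> X \<in> tangent_space M p \<Longrightarrow> metric_norm g1 p X \<le> A * metric_norm g0 p X"
    and A: "0 < A" and C': "C < C'" "0 \<le> C'"
  shows "comparison M g1 g2 \<Omega> \<le> ereal (A * C')"
proof -
  have "comparison M g0 g2 \<Omega> < ereal C'" using le C'(1) by (simp add: order_le_less_trans)
  then obtain a where a: "a < ereal C'" and null: "null_in M {p \<in> \<Omega>. \<exists>X\<in>tangent_space M p - {\<lambda>_. 0}.
      a < ereal (metric_norm g0 p X / metric_norm g2 p X)}"
    unfolding comparison_def by (auto simp: Inf_less_iff)
  have "a < ereal (metric_norm g0 p X / metric_norm g2 p X)"
    if p: "p \<in> \<Omega>" "X \<in> tangent_space M p" and lt: "ereal (A * C') < ereal (metric_norm g1 p X / metric_norm g2 p X)"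
    for p X
  proof -
    have 0: "0 \<le> A * C'" using A C' by simp
    with lt have "0 < metric_norm g1 p X / metric_norm g2 p X" by simp
    then have pos: "0 < metric_norm g2 p X"
      using g1[OF p] by (simp add: zero_less_divide_iff)
    have "A * C' < metric_norm g1 p X / metric_norm g2 p X" using lt by simp
    also have "\<dots> \<le> A * metric_norm g0 p X / metric_norm g2 p X"
      using g10[OF p] pos by (intro divide_right_mono) auto
    also have "\<dots> = A * (metric_norm g0 p X / metric_norm g2 p X)" by simp
    finally have "C' < metric_norm g0 p X / metric_norm g2 p X"
      unfolding mult_less_cancel_left_pos[OF A] .
    with a show ?thesis by (intro order_less_trans[OF a]) simp
  qed
  then have "{p \<in> \<Omega>. \<exists>X\<in>tangent_space M p - {\<lambda>_. 0}. ereal (A * C') < ereal (metric_norm g1 p X / metric_norm g2 p X)}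
      \<subseteq> {p \<in> \<Omega>. \<exists>X\<in>tangent_space M p - {\<lambda>_. 0}. a < ereal (metric_norm g0 p X / metric_norm g2 p X)}"
    by blast
  then show ?thesis
    unfolding comparison_def by (intro Inf_lower) (auto intro: null_in_subset[OF null])
qed

lemma metric_norm_hat_nonneg: "0 \<le> metric_norm (hat_metric M f) p X"
  by (simp add: metric_norm_def hat_metric_def Let_def)

context embedded_region
begin

text \<open>The left-hand side is the Euclidean length of the image of \<open>X\<close> under the differential of \<open>\<phi>\<close>. It is
  the same in all charts around \<open>p\<close>, so one chart is enough.\<close>

definition dominates_embedding :: "('m, 'n) metric \<Rightarrow> real \<Rightarrow> 'm \<Rightarrow> bool" where
  "dominates_embedding g B p \<longleftrightarrow> (\<exists>W c. (W, c) \<in> atlas M \<and> p \<in> W \<and> (\<forall>X\<in>tangent_space M p.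
     L2_set (\<lambda>j. coord_diff (W, c) p j (X (W, c))) {..<K} \<le> B * metric_norm g p X))"

lemma dominates_embeddingE:
  assumes "dominates_embedding g B p"
  obtains W c where "(W, c) \<in> atlas M" "p \<in> W" "\<And>X. X \<in> tangent_space M p \<Longrightarrow>
     L2_set (\<lambda>j. coord_diff (W, c) p j (X (W, c))) {..<K} \<le> B * metric_norm g p X"
  using assms unfolding dominates_embedding_def by (elim exE conjE) (auto intro: that)

lemma dominates_embeddingI:
  assumes "(W, c) \<in> atlas M" "p \<in> W" "\<And>X. X \<in> tangent_space M p \<Longrightarrow>
     L2_set (\<lambda>j. coord_diff (W, c) p j (X (W, c))) {..<K} \<le> B * metric_norm g p X"
  shows "dominates_embedding g B p"
  using assms unfolding dominates_embedding_def by (intro exI conjI ballI)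

end

context affine_reference_map
begin

text \<open>The inverse of \<open>f\<close>, read in a chart, would map a null set onto a set with interior.\<close>

lemma T_not_null: "\<not> null_in M T"
proof
  assume null: "null_in M T"
  define x :: "real^'n" where "x = 0"
  have x: "x \<in> std_simplex UNIV" by (simp add: x_def mem_std_simplex_UNIV)
  obtain W c where a: "(W, c) \<in> atlas M" "f x \<in> W" by (rule chart_ex[OF f_mem_topspace[OF x]])
  have neg: "negligible (c ` (T \<inter> W))"
    using bspec[OF null[unfolded null_in_def] a(1)] by simp
  have "negligible ((inv_into (std_simplex UNIV) f \<circ> inv_into W c) ` c ` (T \<inter> W))"
    by (rule negligible_differentiable_image_negligible[OF le_refl neg])
       (rule smooth_on_set_imp_differentiable_on[OF f_inv_smooth[OF a(1)]])
  moreover have "std_simplex UNIV \<inter> f -` W \<subseteq> (inv_into (std_simplex UNIV) f \<circ> inv_into W c) ` c ` (T \<inter> W)"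
  proof
    fix z assume z: "z \<in> std_simplex UNIV \<inter> f -` W"
    then have "inv_into W c (c (f z)) = f z" by (intro chart_inv[OF a(1)]) blast
    moreover have "inv_into (std_simplex UNIV) f (f z) = z"
      by (rule inv_into_f_f[OF bij_betw_imp_inj_on[OF f_bij]]) (use z in blast)
    moreover have "f z \<in> T \<inter> W" using z f_mem(1) by blast
    ultimately show "z \<in> (inv_into (std_simplex UNIV) f \<circ> inv_into W c) ` c ` (T \<inter> W)"
      by (intro image_eqI[of _ _ "c (f z)"] imageI) (auto simp: o_def)
  qed
  ultimately have negB: "negligible (std_simplex UNIV \<inter> f -` W)" by (rule negligible_subset)
  obtain Q where Q: "open Q" "std_simplex UNIV \<inter> f -` W = std_simplex UNIV \<inter> Q"
    using preimage_openin[OF f_continuous chart_openin[OF a(1)]] unfolding openin_open by blast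
  have "x \<in> Q" using Q(2) x a(2) by blast
  moreover have "x \<in> closure (interior (std_simplex UNIV))"
    using solid_convex_std_simplex x closure_subset
    by (metis convex_closure_interior solid_convex_def subsetD)
  ultimately have "Q \<inter> interior (std_simplex UNIV) \<noteq> {}"
    using Q(1) closure_iff_nhds_not_empty by blast
  moreover have "open (Q \<inter> interior (std_simplex UNIV))" using Q(1) by blast
  moreover have "Q \<inter> interior (std_simplex UNIV) \<subseteq> std_simplex UNIV \<inter> f -` W"
    using Q(2) interior_subset by blast
  ultimately show False using open_not_negligible negligible_subset[OF negB] by blast
qed

text \<open>The linear part of \<open>ft\<close> stretches every vector by at least \<open>m\<close>, and its value on the vector \<open>v\<close> of
  \<open>hat_metric_eq\<close> is the image of \<open>X\<close> under the differential of \<open>\<phi>\<close>.\<close>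

lemma hat_norm_le:
  assumes m: "0 < m" "\<And>v. v \<noteq> 0 \<Longrightarrow> m \<le> stretch K ft v"
    and B: "\<And>p. p \<in> T \<Longrightarrow> dominates_embedding g B p"
    and p: "p \<in> T" and X: "X \<in> tangent_space M p"
  shows "metric_norm (hat_metric M f) p X \<le> B / m * metric_norm g p X"
proof -
  obtain v where v: "metric_norm (hat_metric M f) p X = norm v"
    "\<And>W c j. (W, c) \<in> atlas M \<Longrightarrow> p \<in> W \<Longrightarrow> j < K \<Longrightarrow> ft v j - ft 0 j = coord_diff (W, c) p j (X (W, c))"
    by (rule hat_metric_eq[OF p X]) (rule that)
  obtain W c where a: "(W, c) \<in> atlas M" "p \<in> W"
    and le: "L2_set (\<lambda>j. coord_diff (W, c) p j (X (W, c))) {..<K} \<le> B * metric_norm g p X"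
    using X by (rule_tac dominates_embeddingE[OF B[OF p]]) (rule that)
  have "m * norm v \<le> L2_set (\<lambda>j. ft v j - ft 0 j) {..<K}"
  proof (cases "v = 0")
    case False
    then show ?thesis using m(2)[OF False] by (simp add: stretch_def pos_le_divide_eq)
  qed (simp add: L2_set_nonneg)
  also have "\<dots> = L2_set (\<lambda>j. coord_diff (W, c) p j (X (W, c))) {..<K}"
    using v(2)[OF a] by (intro L2_set_cong) auto
  also note le
  finally show ?thesis using m(1) by (simp add: v(1) field_simps)
qed

end


section \<open>Uniform comparison with the metric pulled back by an embedding\<close>

text \<open>The quotient of the two quadratic forms is continuous on the compact product of \<open>N\<close> with the unit
  sphere, and it is homogeneous of degree \<open>0\<close>.\<close>

lemma quadratic_forms_bound_on_compact:
  fixes G :: "'b::metric_space \<Rightarrow> real^'n \<Rightarrow> real^'n \<Rightarrow> real" and D :: "'b \<Rightarrow> nat \<Rightarrow> real^'n \<Rightarrow> real"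
  assumes N: "compact N"
    and G: "\<And>y. y \<in> N \<Longrightarrow> inner_product_on UNIV (G y)" "\<And>v w. continuous_on N (\<lambda>y. G y v w)"
    and D: "\<And>y j. y \<in> N \<Longrightarrow> j < K \<Longrightarrow> linear (D y j)" "\<And>j v. j < K \<Longrightarrow> continuous_on N (\<lambda>y. D y j v)"
  obtains B where "0 < B" "\<And>y v. y \<in> N \<Longrightarrow> L2_set (\<lambda>j. D y j v) {..<K} \<le> B * sqrt (G y v v)"
proof -
  have D_eq: "D y j v = (\<Sum>i\<in>UNIV. v $ i * D y j (axis i 1))" if "y \<in> N" "j < K" for y j v
  proof -
    interpret linear "D y j" by (rule D(1)[OF that])
    have "D y j (\<Sum>i\<in>UNIV. v $ i *\<^sub>R axis i 1) = (\<Sum>i\<in>UNIV. v $ i * D y j (axis i 1))"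
      by (simp add: sum scale)
    then show ?thesis by (simp add: basis_expansion flip: scalar_mult_eq_scaleR)
  qed
  have linG: "linear (\<lambda>v. G y v w)" and symG: "G y v w = G y w v" if "y \<in> N" for y v w
  proof -
    note ip = G(1)[OF that, unfolded inner_product_on_def]
    show "G y v w = G y w v" using ip by blast
    have *: "G y (r *\<^sub>R u + s *\<^sub>R v) w = r * G y u w + s * G y v w" for u v r s using ip by blast
    show "linear (\<lambda>v. G y v w)"
      using *[of 1 _ 1] *[of _ _ 0] by (intro linearI) auto
  qed
  have G_exp: "G y v w = (\<Sum>i\<in>UNIV. v $ i * G y (axis i 1) w)" if "y \<in> N" for y v w
  proof -
    interpret linear "\<lambda>v. G y v w" by (rule linG[OF that])
    have "G y (\<Sum>i\<in>UNIV. v $ i *\<^sub>R axis i 1) w = (\<Sum>i\<in>UNIV. v $ i * G y (axis i 1) w)"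
      by (simp add: sum scale)
    then show ?thesis by (simp add: basis_expansion flip: scalar_mult_eq_scaleR)
  qed
  have G_eq: "G y v v = (\<Sum>i\<in>UNIV. v $ i * (\<Sum>k\<in>UNIV. v $ k * G y (axis k 1) (axis i 1)))"
    if "y \<in> N" for y v
    by (subst G_exp[OF that], subst symG[OF that], subst G_exp[OF that]) simp
  have G_scale: "G y (r *\<^sub>R v) (r *\<^sub>R v) = r\<^sup>2 * G y v v" if "y \<in> N" for y r v
    using linear_scale[OF linG[OF that]] symG[OF that] by (simp add: power2_eq_square mult.assoc)
  have G_pos: "G y v v > 0" if "y \<in> N" "v \<noteq> 0" for y v
    using G(1)[OF that(1), unfolded inner_product_on_def] that(2) by blast
  \<comment> \<open>Joint continuity in the point and the vector is read off from the expansions above.\<close>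
  define h where "h z = (\<Sum>j<K. (D (fst z) j (snd z))\<^sup>2) / G (fst z) (snd z) (snd z)" for z
  have fst_N: "continuous_on (N \<times> sphere 0 1) (\<lambda>z. q (fst z))" if "continuous_on N q"
    for q :: "'b \<Rightarrow> real"
    by (rule continuous_on_compose2[OF that continuous_on_fst[OF continuous_on_id]]) auto
  have contD: "continuous_on (N \<times> sphere 0 1) (\<lambda>z. D (fst z) j (snd z))" if "j < K" for j
  proof -
    have "continuous_on (N \<times> sphere 0 1) (\<lambda>z. \<Sum>i\<in>UNIV. snd z $ i * D (fst z) j (axis i 1))"
      by (intro continuous_intros fst_N D(2)[OF that])
    then show ?thesis by (rule continuous_on_eq) (auto simp: D_eq[OF _ that, symmetric])
  qed
  have contG: "continuous_on (N \<times> sphere 0 1) (\<lambda>z. G (fst z) (snd z) (snd z))"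
  proof -
    have "continuous_on (N \<times> sphere 0 1) (\<lambda>z. \<Sum>i\<in>UNIV. snd z $ i *
        (\<Sum>k\<in>UNIV. snd z $ k * G (fst z) (axis k 1) (axis i 1)))"
      by (intro continuous_intros fst_N G(2))
    then show ?thesis by (rule continuous_on_eq) (auto simp: G_eq[symmetric])
  qed
  have "continuous_on (N \<times> sphere 0 1) h"
    unfolding h_def[abs_def]
  proof (intro continuous_on_divide continuous_on_sum continuous_on_power contD contG ballI)
    fix z assume "z \<in> N \<times> sphere (0::real^'n) 1"
    then have "fst z \<in> N" "snd z \<noteq> 0" by auto
    then show "G (fst z) (snd z) (snd z) \<noteq> 0" using G_pos by force
  qed simp
  moreover have "compact (N \<times> sphere (0::real^'n) 1)" by (intro compact_Times N compact_sphere)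
  ultimately have "bounded (h ` (N \<times> sphere 0 1))"
    by (intro compact_imp_bounded compact_continuous_image)
  then obtain b where b: "b > 0" "\<And>z. z \<in> N \<times> sphere 0 1 \<Longrightarrow> norm (h z) \<le> b"
    unfolding bounded_pos by blast
  show ?thesis
  proof (rule that[of "sqrt b"])
    show "0 < sqrt b" using b by simp
    fix y v assume y: "y \<in> N"
    have "(\<Sum>j<K. (D y j v)\<^sup>2) \<le> b * G y v v"
    proof (cases "v = 0")
      case True
      then show ?thesis using y D(1) linear_0 G_scale[OF y, of 0 0] by (simp add: linear_0)
    next
      case False
      define r u where "r = norm v" and "u = v /\<^sub>R norm v"
      have u: "v = r *\<^sub>R u" "u \<in> sphere 0 1" "u \<noteq> 0" using False by (auto simp: r_def u_def)
      have *: "(\<Sum>j<K. (D y j v)\<^sup>2) = r\<^sup>2 * (\<Sum>j<K. (D y j u)\<^sup>2)"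
        unfolding sum_distrib_left u(1) using linear_scale[OF D(1)[OF y]]
        by (intro sum.cong) (auto simp: power_mult_distrib)
      have "(\<Sum>j<K. (D y j u)\<^sup>2) \<le> b * G y u u"
        using b(2)[of "(y, u)"] y u G_pos[OF y u(3)] by (auto simp: h_def divide_simps split: if_splits)
      then have "r\<^sup>2 * (\<Sum>j<K. (D y j u)\<^sup>2) \<le> r\<^sup>2 * (b * G y u u)" by (rule mult_left_mono) simp
      also have "\<dots> = b * G y v v" unfolding u(1) G_scale[OF y] by (rule mult.left_commute)
      finally show ?thesis unfolding * .
    qed
    then show "L2_set (\<lambda>j. D y j v) {..<K} \<le> sqrt b * sqrt (G y v v)"
      unfolding L2_set_def real_sqrt_mult[symmetric] by (rule real_sqrt_le_mono)
  qed
qed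

context cornered_manifold
begin

text \<open>This identifies \<open>g p X X\<close> with the coordinate expression of \<open>g\<close> on which smoothness and positivity
  of a Riemannian metric are imposed.\<close>

lemma differential_chart_inv:
  assumes a: "(W, c) \<in> atlas M" and p: "p \<in> W" and X: "X \<in> tangent_space M p"
  shows "differential M (c ` W) (inv_into W c) (c p) (X (W, c)) = X"
proof
  fix b :: "('m, 'n) chart"
  show "differential M (c ` W) (inv_into W c) (c p) (X (W, c)) b = X b"
  proof (cases "b \<in> atlas M \<and> p \<in> fst b")
    case True
    then have "X b = transition_deriv (W, c) b p (X (W, c))"
      by (intro tangent_space_transition[OF X]) (use a p in auto)
    then show ?thesis
      using True unfolding differential_def chart_inv[OF a p] transition_deriv_def
      by (simp only: fst_conv snd_conv simp_thms if_True)
  next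
    case False
    then have "X b = 0" using tangent_space_eq_0[OF X] by blast
    moreover have "differential M (c ` W) (inv_into W c) (c p) (X (W, c)) b = 0"
      unfolding differential_def chart_inv[OF a p] by (rule if_not_P[OF False])
    ultimately show ?thesis by simp
  qed
qed

lemma riemannian_metric_norm_nonneg:
  assumes g: "riemannian_metric M g" and p: "p \<in> topspace (mtop M)" and X: "X \<in> tangent_space M p"
  shows "0 \<le> metric_norm g p X"
proof -
  obtain W c where a: "(W, c) \<in> atlas M" "p \<in> W" by (rule chart_ex[OF p])
  define G where "G = pullback_metric M (c ` W) (inv_into W c) g (c p)"
  have "smooth_metric_on (c ` W) UNIV (pullback_metric M (c ` W) (inv_into W c) g)"
    using bspec[OF g[unfolded riemannian_metric_def] a(1)] by (simp only: prod.case)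
  then have G: "inner_product_on UNIV G" using a(2) unfolding smooth_metric_on_def G_def by blast
  have "0 \<le> G v v" for v
  proof (cases "v = 0")
    case True
    have "G (0 *\<^sub>R v + 0 *\<^sub>R v) v = 0 * G v v + 0 * G v v"
      using G unfolding inner_product_on_def by blast
    then show ?thesis using True by simp
  next
    case False
    then show ?thesis using G unfolding inner_product_on_def by (blast intro: less_imp_le)
  qed
  from this[of "X (W, c)"] have "0 \<le> g p X X"
    unfolding G_def pullback_metric_def differential_chart_inv[OF a X] chart_inv[OF a] .
  then show ?thesis by (simp add: metric_norm_def)
qed

end

context embedded_region
begin

text \<open>Chart images are relatively open in the orthant, which is closed, so every point of them has a
  compact relative neighbourhood, also at corners.\<close>

lemma embedding_bound_near_point:
  assumes g: "riemannian_metric M g" and p0: "p0 \<in> U"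
  obtains Q B where "openin (mtop M) Q" "p0 \<in> Q" "(0::real) < B"
    "\<And>p. p \<in> Q \<Longrightarrow> dominates_embedding g B p"
proof -
  have "p0 \<in> topspace (mtop M)" using p0 openin_subset[OF openU] by blast
  then obtain W c where a: "(W, c) \<in> atlas M" "p0 \<in> W" by (rule chart_ex)
  define A where "A = c ` (W \<inter> U)"
  have A: "openin (top_of_set orthant) A" "c p0 \<in> A"
    using chart_image_openin[OF a(1) openU] a p0 by (auto simp: A_def)
  obtain Q where Q: "open Q" "A = orthant \<inter> Q" using A(1) unfolding openin_open by blast
  then obtain r where r: "r > 0" "cball (c p0) r \<subseteq> Q" using A(2) open_contains_cball by blast
  have "closed (\<Inter>i. {x::real^'n. 0 \<le> x $ i})" by (intro closed_INT ballI closed_halfspace_component_ge_cart)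
  moreover have "(\<Inter>i. {x::real^'n. 0 \<le> x $ i}) = orthant" by (auto simp: orthant_def)
  ultimately have "compact (orthant \<inter> cball (c p0) r)" by (metis closed_Int_compact compact_cball)
  moreover define N where "N = orthant \<inter> cball (c p0) r"
  ultimately have N: "compact N" "N \<subseteq> A" using r(2) Q(2) by auto
  define G where "G = pullback_metric M (c ` W) (inv_into W c) g"
  have smG: "smooth_metric_on (c ` W) UNIV G"
    using bspec[OF g[unfolded riemannian_metric_def] a(1)] by (simp only: prod.case G_def)
  have NW: "N \<subseteq> c ` W" using N(2) by (auto simp: A_def)
  define D where "D y j = coord_diff (W, c) (inv_into W c y) j" for y j
  have inv_A: "inv_into W c y \<in> W \<inter> U" "c (inv_into W c y) = y" if "y \<in> A" for y
    using that chart_inv[OF a(1)] by (auto simp: A_def)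
  have contD: "continuous_on N (\<lambda>y. D y j v)" if "j < K" for j v
  proof -
    have "continuous_on A (\<lambda>y. deriv_within A (\<lambda>x. \<phi> (inv_into W c x) j) y v)"
      using continuous_on_deriv_within[OF solid_convex_orthant A(1)] smooth_phi[OF a(1) that]
      unfolding A_def by blast
    then have "continuous_on A (\<lambda>y. D y j v)"
      by (rule continuous_on_eq) (simp add: D_def coord_diff_def inv_A flip: A_def)
    then show ?thesis using N(2) continuous_on_subset by blast
  qed
  obtain B where B: "0 < B" "\<And>y v. y \<in> N \<Longrightarrow> L2_set (\<lambda>j. D y j v) {..<K} \<le> B * sqrt (G y v v)"
  proof (rule quadratic_forms_bound_on_compact[OF N(1)])
    show "inner_product_on UNIV (G y)" if "y \<in> N" for y
      using smG that NW unfolding smooth_metric_on_def by blast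
    show "continuous_on N (\<lambda>y. G y v w)" for v w
    proof -
      have "smooth_on_set (c ` W) (\<lambda>y. G y v w)" using smG unfolding smooth_metric_on_def by blast
      from smooth_on_set_imp_continuous_on[OF this] show ?thesis using NW by (rule continuous_on_subset)
    qed
    show "linear (D y j)" if "y \<in> N" "j < K" for y j
      unfolding D_def using that N(2) inv_A(1) by (intro linear_coord_diff[OF a(1)]) blast+
  qed (use contD in blast)+
  show ?thesis
  proof (rule that[of "{p \<in> W. c p \<in> ball (c p0) r} \<inter> U" B])
    show "openin (mtop M) ({p \<in> W. c p \<in> ball (c p0) r} \<inter> U)"
      by (intro openin_Int chart_preimage_openin[OF a(1)] openU open_ball)
    show "p0 \<in> {p \<in> W. c p \<in> ball (c p0) r} \<inter> U" using a p0 r by simp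
    show "0 < B" by (rule B)
    fix p assume p: "p \<in> {p \<in> W. c p \<in> ball (c p0) r} \<inter> U"
    then have pW: "p \<in> W" "c p \<in> A" by (auto simp: A_def)
    then have cp: "c p \<in> N" using p Q(2) by (auto simp: N_def)
    have "L2_set (\<lambda>j. coord_diff (W, c) p j (X (W, c))) {..<K} \<le> B * metric_norm g p X"
      if X: "X \<in> tangent_space M p" for X
      using B(2)[OF cp, of "X (W, c)"]
      unfolding D_def G_def pullback_metric_def metric_norm_def chart_inv[OF a(1) pW(1)]
        differential_chart_inv[OF a(1) pW(1) X] .
    with a(1) pW(1) show "dominates_embedding g B p" by (rule dominates_embeddingI)
  qed
qed

lemma embedding_bound_on_compact:
  assumes g: "riemannian_metric M g" and V: "compactin (mtop M) V" "V \<subseteq> U"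
  obtains B where "(0::real) < B"
    "\<And>p. p \<in> V \<Longrightarrow> dominates_embedding g B p"
proof -
  have pos: "0 \<le> metric_norm g p X" if "p \<in> V" "X \<in> tangent_space M p" for p X
    by (rule riemannian_metric_norm_nonneg[OF g _ that(2)])
       (use that V(2) openin_subset[OF openU] in blast)
  have mono: "dominates_embedding g B' p"
    if B: "dominates_embedding g B p" "B \<le> B'" and p: "p \<in> V" for B B' p
  proof -
    obtain W c where a: "(W, c) \<in> atlas M" "p \<in> W" "\<And>X. X \<in> tangent_space M p \<Longrightarrow>
        L2_set (\<lambda>j. coord_diff (W, c) p j (X (W, c))) {..<K} \<le> B * metric_norm g p X"
      by (rule dominates_embeddingE[OF B(1)]) (rule that)
    have "L2_set (\<lambda>j. coord_diff (W, c) p j (X (W, c))) {..<K} \<le> B' * metric_norm g p X"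
      if X: "X \<in> tangent_space M p" for X
      using a(3)[OF X] mult_right_mono[OF B(2) pos[OF p X]] by (rule order_trans)
    with a(1,2) show ?thesis by (rule dominates_embeddingI)
  qed
  have "\<exists>Q B. openin (mtop M) Q \<and> p0 \<in> Q \<and> 0 < B \<and> (\<forall>p\<in>Q. dominates_embedding g B p)" if "p0 \<in> V" for p0
    by (rule embedding_bound_near_point[OF g subsetD[OF V(2) that]]) blast
  then obtain Q B where QB: "\<And>p0. p0 \<in> V \<Longrightarrow>
      openin (mtop M) (Q p0) \<and> p0 \<in> Q p0 \<and> 0 < (B p0 :: real) \<and> (\<forall>p\<in>Q p0. dominates_embedding g (B p0) p)"
    by metis
  have cover: "(\<forall>U\<in>Q ` V. openin (mtop M) U) \<and> V \<subseteq> \<Union>(Q ` V)" using QB by blast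
  obtain \<F> where F: "finite \<F>" "\<F> \<subseteq> Q ` V" "V \<subseteq> \<Union>\<F>"
    using mp[OF spec[OF conjunct2[OF V(1)[unfolded compactin_def]]] cover] by blast
  then obtain P where P: "finite P" "P \<subseteq> V" "V \<subseteq> \<Union>(Q ` P)"
    using finite_subset_image[OF F(1,2)] F(3) by blast
  show ?thesis
  proof (rule that[of "1 + sum B P"])
    have Bpos: "0 \<le> B p" if "p \<in> P" for p using QB P(2) that by fastforce
    then show "0 < 1 + sum B P" using sum_nonneg[of P B] by fastforce
    fix p assume p: "p \<in> V"
    then obtain p0 where p0: "p0 \<in> P" "p \<in> Q p0" using P(3) by blast
    have "B p0 \<le> 1 + sum B P" using member_le_sum[of p0 P B] p0(1) P(1) Bpos by fastforce
    moreover have "dominates_embedding g (B p0) p" using QB[of p0] p0 P(2) by blast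
    ultimately show "dominates_embedding g (1 + sum B P) p" using mono p by blast
  qed
qed

end

section \<open>Orientation\<close>

context affine_reference_map
begin

definition jacobian :: "('m \<Rightarrow> real^'n) \<Rightarrow> real^'n \<Rightarrow> real" where
  "jacobian c x = det (matrix (deriv_within (std_simplex UNIV) (c \<circ> f) x))"

lemma linear_deriv_f:
  "(W, c) \<in> atlas M \<Longrightarrow> x \<in> std_simplex UNIV \<Longrightarrow> f x \<in> W \<Longrightarrow>
    linear (deriv_within (std_simplex UNIV) (c \<circ> f) x)"
  using smooth_into_has_derivative[OF f_smooth_into] has_derivative_linear by blast

lemma jacobian_nonzero:
  assumes a: "(W, c) \<in> atlas M" and x: "x \<in> std_simplex UNIV" "f x \<in> W"
  shows "jacobian c x \<noteq> 0"
proof -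
  have lin: "linear (deriv_within (std_simplex UNIV) (c \<circ> f) x)" by (rule linear_deriv_f[OF a x])
  have "inj (deriv_within (std_simplex UNIV) (c \<circ> f) x)"
    unfolding linear_injective_0[OF lin] using deriv_f_in_chart_injective[OF a x] by blast
  then show ?thesis unfolding jacobian_def det_nz_iff_inj[OF lin] .
qed

lemma jacobian_transition:
  assumes a: "(W, c) \<in> atlas M" and b: "(V, d) \<in> atlas M"
    and x: "x \<in> std_simplex UNIV" "f x \<in> W" "f x \<in> V"
  shows "jacobian d x = det (matrix (transition_deriv (W, c) (V, d) (f x))) * jacobian c x"
proof -
  have WV: "f x \<in> W \<inter> V" using x by blast
  have "deriv_within (std_simplex UNIV) (d \<circ> f) x =
      transition_deriv (W, c) (V, d) (f x) \<circ> deriv_within (std_simplex UNIV) (c \<circ> f) x"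
    using smooth_into_transition[OF solid_convex_std_simplex f_smooth_into x(1) WV a b]
    unfolding fun_eq_iff comp_apply by blast
  moreover have "linear (transition_deriv (W, c) (V, d) (f x))"
    using transition_has_derivative[OF a b WV] has_derivative_linear by blast
  ultimately show ?thesis
    unfolding jacobian_def using matrix_compose[OF linear_deriv_f[OF a x(1,2)]] by (metis det_mul)
qed

lemma continuous_on_jacobian:
  assumes a: "(W, c) \<in> atlas M"
  shows "continuous_on (std_simplex UNIV \<inter> f -` W) (jacobian c)"
proof -
  define B where "B = std_simplex UNIV \<inter> f -` W"
  have B: "openin (top_of_set (std_simplex UNIV)) B"
    unfolding B_def by (rule preimage_openin[OF f_continuous chart_openin[OF a]])
  have "continuous_on B (\<lambda>x. deriv_within B (c \<circ> f) x v)" for v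
    by (rule continuous_on_deriv_within[OF solid_convex_std_simplex B])
       (use smooth_into_chart[OF f_smooth_into a] in \<open>simp add: B_def\<close>)
  then have "continuous_on B (\<lambda>x. deriv_within (std_simplex UNIV) (c \<circ> f) x v)" for v
    by (rule continuous_on_eq) (simp only: at_within_openin[OF B])
  then have "continuous_on B (\<lambda>x. matrix (deriv_within (std_simplex UNIV) (c \<circ> f) x) $ i $ j)" for i j
    unfolding matrix_def by (simp add: continuous_on_component)
  then show ?thesis
    unfolding jacobian_def[abs_def] det_def B_def[symmetric]
    by (intro continuous_on_sum continuous_on_mult continuous_on_prod continuous_on_const)
qed

text \<open>A change of chart multiplies the sign of the Jacobian and the orientation by the same sign, so their
  product is a function on the simplex. In a single chart both factors are continuous, and a continuous
  function with values \<open>1\<close> and \<open>-1\<close> on a connected set is constant.\<close>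

lemma orientation_sign_constant:
  assumes or: "oriented M"
  obtains s where "s \<in> {-1, 1 :: real}"
    "\<And>W c x. (W, c) \<in> atlas M \<Longrightarrow> x \<in> std_simplex UNIV \<Longrightarrow> f x \<in> W \<Longrightarrow>
      sgn (jacobian c x) = s * orient M (W, c) (f x)"
proof -
  have or1: "orient M (W, c) p \<in> {-1, 1}" if "(W, c) \<in> atlas M" "p \<in> W" for W c p
    using or that unfolding oriented_def by (metis fst_conv)
  have or2: "continuous_map (subtopology (mtop M) W) euclideanreal (orient M (W, c))"
    if "(W, c) \<in> atlas M" for W c
    using or that unfolding oriented_def by (metis fst_conv)
  have or3: "orient M (V, d) p = sgn (det (matrix (transition_deriv (W, c) (V, d) p))) * orient M (W, c) p"
    if "(W, c) \<in> atlas M" "(V, d) \<in> atlas M" "p \<in> W" "p \<in> V" for W c V d p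
    using bspec[OF bspec[OF conjunct2[OF conjunct2[OF or[unfolded oriented_def]]] that(1)] that(2)] that(3,4)
    by simp
  define s where "s W c x = sgn (jacobian c x) * orient M (W, c) (f x)" for W c x
  have s_range: "s W c x \<in> {-1, 1}"
    if "(W, c) \<in> atlas M" "x \<in> std_simplex UNIV" "f x \<in> W" for W c x
    using or1[OF that(1,3)] jacobian_nonzero[OF that] by (auto simp: s_def sgn_if)
  have s_indep: "s V d x = s W c x"
    if "(W, c) \<in> atlas M" "(V, d) \<in> atlas M" "x \<in> std_simplex UNIV" "f x \<in> W" "f x \<in> V" for W c V d x
  proof -
    define t where "t = det (matrix (transition_deriv (W, c) (V, d) (f x)))"
    have "t \<noteq> 0" using jacobian_transition[OF that] jacobian_nonzero[OF that(2,3,5)] by (auto simp: t_def)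
    then have "sgn t * sgn t = 1" by (simp add: sgn_if)
    moreover have "s V d x = (sgn t * sgn t) * s W c x"
      unfolding s_def jacobian_transition[OF that] or3[OF that(1,2,4,5)] t_def[symmetric] sgn_mult
      by (simp add: mult_ac)
    ultimately show ?thesis by simp
  qed
  \<comment> \<open>The sign as a function on the simplex, glued from the charts.\<close>
  define r where "r x = (SOME y. \<exists>W c. (W, c) \<in> atlas M \<and> f x \<in> W \<and> y = s W c x)" for x
  have r_eq: "r x = s W c x" if "(W, c) \<in> atlas M" "x \<in> std_simplex UNIV" "f x \<in> W" for W c x
    unfolding r_def
  proof (rule some_equality)
    show "\<exists>V d. (V, d) \<in> atlas M \<and> f x \<in> V \<and> s W c x = s V d x" using that by blast
  next
    fix y assume "\<exists>V d. (V, d) \<in> atlas M \<and> f x \<in> V \<and> y = s V d x"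
    then show "y = s W c x" using s_indep[OF that(1) _ that(2,3)] by blast
  qed
  have contr: "continuous_on (std_simplex UNIV) r"
    unfolding continuous_on_eq_continuous_within
  proof
    fix x :: "real^'n" assume x: "x \<in> std_simplex UNIV"
    obtain W c where a: "(W, c) \<in> atlas M" "f x \<in> W" by (rule chart_ex[OF f_mem_topspace[OF x]])
    define B where "B = std_simplex UNIV \<inter> f -` W"
    have B: "openin (top_of_set (std_simplex UNIV)) B"
      unfolding B_def by (rule preimage_openin[OF f_continuous chart_openin[OF a(1)]])
    have xB: "x \<in> B" using x a(2) by (simp add: B_def)
    have "continuous_map (top_of_set B) (subtopology (mtop M) W) f"
      unfolding continuous_map_in_subtopology
      using continuous_map_from_subtopology[OF f_continuous, of B]
      by (auto simp: B_def subtopology_subtopology)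
    then have "continuous_map (top_of_set B) euclideanreal (orient M (W, c) \<circ> f)"
      using continuous_map_compose or2[OF a(1)] by blast
    then have "continuous_on B (\<lambda>x. orient M (W, c) (f x))" by (simp add: o_def)
    moreover have "\<forall>x\<in>B. jacobian c x \<noteq> 0" using jacobian_nonzero[OF a(1)] by (simp add: B_def)
    moreover have "continuous_on B (jacobian c)" unfolding B_def by (rule continuous_on_jacobian[OF a(1)])
    ultimately have "continuous_on B (s W c)"
      unfolding s_def[abs_def] by (intro continuous_on_mult continuous_on_sgn)
    then have "continuous_on B r" by (rule continuous_on_eq) (use r_eq[OF a(1)] in \<open>simp add: B_def\<close>)
    then have "continuous (at x within B) r" using xB continuous_on_eq_continuous_within by blast
    then show "continuous (at x within std_simplex UNIV) r" unfolding at_within_openin[OF B xB] .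
  qed
  have r_range: "r x \<in> {-1, 1}" if x: "x \<in> std_simplex UNIV" for x
  proof -
    obtain W c where a: "(W, c) \<in> atlas M" "f x \<in> W" by (rule chart_ex[OF f_mem_topspace[OF x]])
    show ?thesis unfolding r_eq[OF a(1) x a(2)] by (rule s_range[OF a(1) x a(2)])
  qed
  from r_range have "r ` std_simplex UNIV \<subseteq> {-1, 1}" by (rule image_subsetI)
  then have "finite (r ` std_simplex UNIV)" by (rule finite_subset) simp
  moreover have "connected (std_simplex UNIV :: (real^'n) set)"
    using solid_convex_std_simplex convex_connected unfolding solid_convex_def by blast
  ultimately have "r constant_on std_simplex UNIV" using contr by (intro continuous_finite_range_constant)
  then obtain s0 where s0: "\<And>x. x \<in> std_simplex UNIV \<Longrightarrow> r x = s0" unfolding constant_on_def by blast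
  show ?thesis
  proof (rule that[of s0])
    have 0: "(0::real^'n) \<in> std_simplex UNIV" by (simp add: mem_std_simplex_UNIV)
    show "s0 \<in> {-1, 1}" using r_range[OF 0] s0[OF 0] by simp
    fix W c x assume a: "(W, c) \<in> atlas M" and x: "x \<in> std_simplex UNIV" "f x \<in> W"
    have "orient M (W, c) (f x) * orient M (W, c) (f x) = 1" using or1[OF a x(2)] by auto
    moreover have "s0 = sgn (jacobian c x) * orient M (W, c) (f x)"
      using s0[OF x(1)] r_eq[OF a x] by (simp add: s_def)
    ultimately show "sgn (jacobian c x) = s0 * orient M (W, c) (f x)" by (simp add: mult.assoc)
  qed
qed

end

lemma involution_image:
  assumes "\<And>x. x \<in> A \<Longrightarrow> s x \<in> A" "\<And>x. s (s x) = x"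
  shows "s ` A = A"
proof
  show "A \<subseteq> s ` A" using assms by (metis image_eqI subsetI)
qed (use assms(1) in blast)

text \<open>For \<open>n = 1\<close> the reflection exchanges the two end points; for \<open>n \<ge> 2\<close> it exchanges two coordinates.
  Exchanging the origin with another vertex would not be an isometry when \<open>n \<ge> 2\<close>.\<close>

lemma std_simplex_reflection:
  obtains \<sigma> R :: "real^'n::finite \<Rightarrow> real^'n" where
    "linear R" "\<And>x. \<sigma> x = \<sigma> 0 + R x" "\<And>v. norm (R v) = norm v" "det (matrix R) < 0"
    "\<sigma> ` std_simplex UNIV = std_simplex UNIV" "\<And>x. \<sigma> (\<sigma> x) = x"
proof (cases "CARD('n) = 1")
  case True
  then obtain i where i: "(UNIV :: 'n set) = {i}" using card_1_singletonE by blast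
  define R :: "real^'n \<Rightarrow> real^'n" where "R = (*\<^sub>R) (- 1)"
  define \<sigma> where "\<sigma> x = (\<chi> k. 1) + R x" for x
  have inv: "\<sigma> (\<sigma> x) = x" for x by (simp add: \<sigma>_def R_def)
  have mem: "y \<in> std_simplex UNIV \<longleftrightarrow> 0 \<le> y $ i \<and> y $ i \<le> 1" for y :: "real^'n"
  proof -
    have "k = i" for k :: 'n using i by blast
    then have "(\<forall>k. 0 \<le> y $ k) \<longleftrightarrow> 0 \<le> y $ i" for y :: "real^'n" by metis
    moreover have "(\<Sum>k\<in>UNIV. y $ k) = y $ i" for y :: "real^'n" unfolding i by simp
    ultimately show ?thesis unfolding mem_std_simplex_UNIV by simp
  qed
  have sub: "\<sigma> x \<in> std_simplex UNIV" if "x \<in> std_simplex UNIV" for x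
    using that by (simp add: mem \<sigma>_def R_def)
  show ?thesis
  proof (rule that[of R \<sigma>])
    show "linear R" unfolding R_def by (rule linear_scale_self)
    show "\<sigma> x = \<sigma> 0 + R x" for x by (simp add: \<sigma>_def R_def)
    show "norm (R v) = norm v" for v by (simp add: R_def)
    show "det (matrix R) < 0" unfolding R_def det_matrix_scaleR True by simp
    show "\<sigma> ` std_simplex UNIV = std_simplex UNIV" by (rule involution_image[OF sub inv])
  qed (rule inv)
next
  case False
  have "\<exists>i j :: 'n. i \<noteq> j"
  proof (rule ccontr)
    assume "\<not> (\<exists>i j :: 'n. i \<noteq> j)"
    then have "(UNIV :: 'n set) = {undefined}" by auto
    then have "CARD('n) = card {undefined :: 'n}" by simp
    then show False using False by simp
  qed
  then obtain i j :: 'n where ij: "i \<noteq> j" by blast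
  define p where "p = Transposition.transpose i j"
  have p: "p permutes UNIV" unfolding p_def by (rule permutes_swap_id) auto
  have pp: "p (p k) = k" for k by (simp add: p_def)
  define R :: "real^'n \<Rightarrow> real^'n" where "R v = (\<chi> k. v $ p k)" for v
  have sum_p: "(\<Sum>k\<in>UNIV. q (p k)) = (\<Sum>k\<in>UNIV. q k)" for q :: "'n \<Rightarrow> real"
    using sum.permute[OF p, of q] by (simp add: o_def)
  have inv: "R (R x) = x" for x by (simp add: R_def pp vec_eq_iff)
  have sub: "R x \<in> std_simplex UNIV" if "x \<in> std_simplex UNIV" for x
    using that by (simp add: mem_std_simplex_UNIV R_def sum_p)
  show ?thesis
  proof (rule that[of R R])
    show "linear R" by (intro linearI) (simp_all add: R_def vec_eq_iff)
    show "R x = R 0 + R x" for x by (simp add: R_def vec_eq_iff)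
    show "norm (R v) = norm v" for v
      using sum_p[of "\<lambda>k. (v $ k)\<^sup>2"] by (simp add: norm_vec_def L2_set_def R_def)
    have "matrix R = (\<chi> k. mat 1 $ p k)"
      by (simp add: matrix_def R_def vec_eq_iff mat_def axis_def)
    then have "det (matrix R) = of_int (sign p) * det (mat 1 :: real^'n^'n)"
      using det_permute_rows[OF p, of "mat 1 :: real^'n^'n"] by simp
    then show "det (matrix R) < 0" using ij by (simp add: p_def sign_swap_id)
    show "R ` std_simplex UNIV = std_simplex UNIV" by (rule involution_image[OF sub inv])
  qed (rule inv)
qed

context affine_reference_map
begin

text \<open>Precomposition with the reflection replaces \<open>ft\<close> by another affine parametrization of the same
  simplex, with reversed orientation and the same hat norm.\<close>

lemma oriented_reference_map:
  assumes or: "oriented M"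
  obtains f' where "diffeo_simplex M f' T" "orientation_preserving M f'"
    "\<And>p X. p \<in> T \<Longrightarrow> X \<in> tangent_space M p \<Longrightarrow>
      metric_norm (hat_metric M f') p X = metric_norm (hat_metric M f) p X"
proof -
  obtain s where s: "s \<in> {-1, 1 :: real}"
    "\<And>W c x. (W, c) \<in> atlas M \<Longrightarrow> x \<in> std_simplex UNIV \<Longrightarrow> f x \<in> W \<Longrightarrow>
      sgn (jacobian c x) = s * orient M (W, c) (f x)"
    by (rule orientation_sign_constant[OF or]) (rule that)
  show ?thesis
  proof (cases "s = 1")
    case True
    have "orientation_preserving M f"
      unfolding orientation_preserving_def
    proof (intro ballI impI)
      fix x a assume *: "x \<in> std_simplex UNIV" "a \<in> atlas M" "f x \<in> fst a"
      from s(2)[of "fst a" "snd a" x] * True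
      show "sgn (det (matrix (deriv_within (std_simplex UNIV) (snd a \<circ> f) x))) = orient M a (f x)"
        unfolding jacobian_def prod.collapse by simp
    qed
    with f_diffeo show ?thesis by (rule that) (rule refl)
  next
    case False
    obtain \<sigma> R :: "real^'n \<Rightarrow> real^'n" where R: "linear R" and \<sigma>: "\<And>x. \<sigma> x = \<sigma> 0 + R x"
      and norm_R: "\<And>v. norm (R v) = norm v" and det_R: "det (matrix R) < 0"
      and \<sigma>_simplex: "\<sigma> ` std_simplex UNIV = std_simplex UNIV" and \<sigma>\<sigma>: "\<And>x. \<sigma> (\<sigma> x) = x"
      by (rule std_simplex_reflection) (rule that)
    have lin\<sigma>: "ft (\<sigma> v) j - ft (\<sigma> 0) j = ft (R v) j - ft 0 j" for v j
    proof -
      have "ft (\<sigma> v) j - ft 0 j = (ft (\<sigma> 0) j - ft 0 j) + (ft (R v) j - ft 0 j)"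
        by (subst \<sigma>) (rule linear_add[OF linear_part])
      then show ?thesis by simp
    qed
    interpret reflected: affine_reference_map M U K \<phi> T "ft \<circ> \<sigma>"
    proof unfold_locales
      show "T \<subseteq> U" by (rule T_sub)
      have "linear (\<lambda>v. ft (R v) j - ft 0 j)" for j
        using linear_compose[OF R linear_part] by (simp add: o_def)
      moreover have "range (ft \<circ> \<sigma>) \<subseteq> topspace (Euclidean_space K)"
        using affine unfolding affine_map_into_def by (auto simp: image_subset_iff)
      ultimately show "affine_map_into K (ft \<circ> \<sigma>)"
        unfolding affine_map_into_def comp_apply lin\<sigma> by blast
      have "inj \<sigma>" using \<sigma>\<sigma> by (metis injI)
      then show "inj (ft \<circ> \<sigma>)" using inj_ft inj_compose by blast
      show "(ft \<circ> \<sigma>) ` std_simplex UNIV = \<phi> ` T"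
        unfolding image_comp[symmetric] \<sigma>_simplex by (rule image_ft)
    qed
    have der\<sigma>: "(\<sigma> has_derivative R) (at x within A)" for x A
    proof -
      have "((\<lambda>x. \<sigma> 0 + R x) has_derivative (\<lambda>v. 0 + R v)) (at x within A)"
        by (intro has_derivative_add has_derivative_const bounded_linear_imp_has_derivative
            R[unfolded linear_conv_bounded_linear])
      moreover have "(\<lambda>x. \<sigma> 0 + R x) = \<sigma>" by (rule ext) (rule \<sigma>[symmetric])
      ultimately show ?thesis by simp
    qed
    have f_eq: "reflected.f x = f (\<sigma> x)" for x by simp
    have jac: "reflected.jacobian c x = jacobian c (\<sigma> x) * det (matrix R)"
      if a: "(W, c) \<in> atlas M" and x: "x \<in> std_simplex UNIV" "reflected.f x \<in> W" for W c x
    proof -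
      have \<sigma>x: "\<sigma> x \<in> std_simplex UNIV" "f (\<sigma> x) \<in> W" using x \<sigma>_simplex by auto
      have "((\<lambda>y. (c \<circ> f) (\<sigma> y)) has_derivative (\<lambda>v. deriv_within (std_simplex UNIV) (c \<circ> f) (\<sigma> x) (R v)))
          (at x within std_simplex UNIV)"
        by (rule has_derivative_in_compose[OF der\<sigma>], unfold \<sigma>_simplex)
           (rule smooth_into_has_derivative[OF f_smooth_into a \<sigma>x])
      then have "((c \<circ> reflected.f) has_derivative (deriv_within (std_simplex UNIV) (c \<circ> f) (\<sigma> x) \<circ> R))
          (at x within std_simplex UNIV)"
        by (simp only: o_def)
      then have "deriv_within (std_simplex UNIV) (c \<circ> reflected.f) x = deriv_within (std_simplex UNIV) (c \<circ> f) (\<sigma> x) \<circ> R"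
        by (rule deriv_within_eqI[OF solid_convex_std_simplex openin_subtopology_self x(1)])
      then show ?thesis
        unfolding reflected.jacobian_def jacobian_def
        using matrix_compose[OF R linear_deriv_f[OF a \<sigma>x]] by (metis det_mul)
    qed
    have "orientation_preserving M reflected.f"
      unfolding orientation_preserving_def
    proof (intro ballI impI)
      fix x a assume x: "x \<in> std_simplex UNIV" and a: "a \<in> atlas M" "reflected.f x \<in> fst a"
      have a': "(fst a, snd a) \<in> atlas M" using a(1) by simp
      have \<sigma>x: "\<sigma> x \<in> std_simplex UNIV" "f (\<sigma> x) \<in> fst a" using x a(2) \<sigma>_simplex by auto
      have "sgn (reflected.jacobian (snd a) x) = sgn (jacobian (snd a) (\<sigma> x)) * sgn (det (matrix R))"
        unfolding jac[OF a' x a(2)] by (rule sgn_mult)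
      also have "\<dots> = orient M a (f (\<sigma> x))"
        using s(2)[OF a' \<sigma>x] s(1) False det_R by simp
      finally show "sgn (det (matrix (deriv_within (std_simplex UNIV) (snd a \<circ> reflected.f) x))) = orient M a (reflected.f x)"
        unfolding reflected.jacobian_def f_eq .
    qed
    moreover have "metric_norm (hat_metric M reflected.f) p X = metric_norm (hat_metric M f) p X"
      if p: "p \<in> T" and X: "X \<in> tangent_space M p" for p X
    proof -
      obtain v where v: "metric_norm (hat_metric M f) p X = norm v"
        "\<And>W c j. (W, c) \<in> atlas M \<Longrightarrow> p \<in> W \<Longrightarrow> j < K \<Longrightarrow> ft v j - ft 0 j = coord_diff (W, c) p j (X (W, c))"
        by (rule hat_metric_eq[OF p X]) (rule that)
      obtain v' where v': "metric_norm (hat_metric M reflected.f) p X = norm v'"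
        "\<And>W c j. (W, c) \<in> atlas M \<Longrightarrow> p \<in> W \<Longrightarrow> j < K \<Longrightarrow>
          (ft \<circ> \<sigma>) v' j - (ft \<circ> \<sigma>) 0 j = coord_diff (W, c) p j (X (W, c))"
        by (rule reflected.hat_metric_eq[OF p X]) (rule that)
      have "p \<in> topspace (mtop M)" using p T_sub openin_subset[OF openU] by blast
      then obtain W c where a: "(W, c) \<in> atlas M" "p \<in> W" by (rule chart_ex)
      have "v - R v' = 0"
      proof (rule linear_part_injective)
        fix j assume j: "j < K"
        have "ft (v - R v') j - ft 0 j = (ft v j - ft 0 j) - (ft (R v') j - ft 0 j)"
          by (rule linear_diff[OF linear_part])
        also have "\<dots> = 0"
          using v(2)[OF a j] v'(2)[OF a j] lin\<sigma>[of v' j] by simp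
        finally show "ft (v - R v') j - ft 0 j = 0" .
      qed
      then show ?thesis using v(1) v'(1) norm_R by simp
    qed
    ultimately show ?thesis by (rule that[OF reflected.f_diffeo])
  qed
qed

end


section \<open>Quasi-uniformity\<close>

text \<open>Positivity of \<open>g T\<close> is imposed on the pullback by parametrizations of \<open>T\<close>; any one of them reaches
  the tangent space of \<open>M\<close>, as \<open>T\<close> has full dimension.\<close>

lemma regge_metric_norm_positive:
  assumes M: "manifold_with_corners M" and g: "regge_metric M \<T> g" and T: "T \<in> n_simplices M \<T>"
    and p: "p \<in> T"
  shows "\<exists>X\<in>tangent_space M p - {\<lambda>_. 0}. 0 < metric_norm (g T) p X"
proof -
  interpret cornered_manifold M by unfold_locales (rule M)
  obtain F where T\<T>: "T \<in> \<T>" and F: "embeds_simplex M F UNIV T"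
    using T unfolding n_simplices_def by blast
  have "riemannian_metric_on_simplex M T (g T)"
    using bspec[OF conjunct1[OF g[unfolded regge_metric_def]] T\<T>] .
  then have sm: "smooth_metric_on (std_simplex UNIV) (coord_space UNIV)
      (pullback_metric M (std_simplex UNIV) F (g T))"
    using F unfolding riemannian_metric_on_simplex_def by blast
  have "p \<in> F ` std_simplex UNIV" using F p unfolding embeds_simplex_def by blast
  then obtain x where x: "x \<in> std_simplex UNIV" "F x = p" by blast
  define v :: "real^'b" where "v = (\<chi> k. 1)"
  have v: "v \<noteq> 0" "v \<in> coord_space UNIV" by (auto simp: v_def vec_eq_iff coord_space_def)
  define X where "X = differential M (std_simplex UNIV) F x v"
  have smooth: "smooth_into M (std_simplex UNIV) F" using F unfolding embeds_simplex_def by blast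
  have "X \<in> tangent_space M p"
    unfolding X_def x(2)[symmetric]
    by (rule differential_in_tangent_space[OF solid_convex_std_simplex smooth x(1)])
  moreover have "X \<noteq> (\<lambda>_. 0)"
    using F x(1) v unfolding embeds_simplex_def X_def by blast
  moreover have "0 < pullback_metric M (std_simplex UNIV) F (g T) x v v"
    using sm x(1) v unfolding smooth_metric_on_def inner_product_on_def by blast
  then have "0 < metric_norm (g T) p X"
    unfolding pullback_metric_def metric_norm_def X_def x(2) by simp
  ultimately show ?thesis by blast
qed

context affine_reference_map
begin

text \<open>The three estimates for a single simplex. Since \<open>C\<close> is an arbitrary real, \<open>max C 0 + 1\<close> serves as a
  non-negative number above it.\<close>

lemma oriented_reference_map_bounds:
  assumes or: "oriented M" and g: "riemannian_metric M g"
    and g'_pos: "\<And>p. p \<in> T \<Longrightarrow> \<exists>X\<in>tangent_space M p - {\<lambda>_. 0}. 0 < metric_norm g' p X"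
    and m: "0 < m" "\<And>v. v \<noteq> 0 \<Longrightarrow> m \<le> stretch K ft v"
    and B: "0 < B" "\<And>p. p \<in> T \<Longrightarrow> dominates_embedding g B p"
    and C: "comparison M g g' T \<le> ereal C"
  obtains f' where "diffeo_simplex M f' T" "orientation_preserving M f'"
    "comparison M g' (hat_metric M f') T = comparison M g' (hat_metric M f) T"
    "0 \<le> comparison M g' (hat_metric M f') T" "0 \<le> comparison M (hat_metric M f') g' T"
    "comparison M (hat_metric M f') g' T \<le> ereal (B / m * (max C 0 + 1))"
proof -
  obtain f' where f': "diffeo_simplex M f' T" "orientation_preserving M f'"
    and hat: "\<And>p X. p \<in> T \<Longrightarrow> X \<in> tangent_space M p \<Longrightarrow>
      metric_norm (hat_metric M f') p X = metric_norm (hat_metric M f) p X"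
    by (rule oriented_reference_map[OF or]) (rule that)
  have cong: "comparison M g' (hat_metric M f') T = comparison M g' (hat_metric M f) T"
    by (rule comparison_cong[OF refl hat])
  have pos: "0 \<le> metric_norm g' p X / metric_norm (hat_metric M f') p X"
      "0 \<le> metric_norm (hat_metric M f') p X / metric_norm g' p X"
    if "0 < metric_norm g' p X" for p X
    using that metric_norm_hat_nonneg[of M f' p X] by simp_all
  have nonneg: "0 \<le> comparison M g' (hat_metric M f') T" "0 \<le> comparison M (hat_metric M f') g' T"
    by (rule comparison_nonneg[OF T_not_null], use g'_pos pos in blast)+
  have "comparison M (hat_metric M f') g' T \<le> ereal (B / m * (max C 0 + 1))"
  proof (rule comparison_le_mult[OF C metric_norm_hat_nonneg])
    show "metric_norm (hat_metric M f') p X \<le> B / m * metric_norm g p X"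
      if "p \<in> T" "X \<in> tangent_space M p" for p X
      unfolding hat[OF that] by (rule hat_norm_le[OF m B(2) that])
    show "0 < B / m" using B(1) m(1) by simp
  qed auto
  with f' cong nonneg show ?thesis by (rule that)
qed

end

theorem lemma12:
  fixes M :: "('m, 'n::finite) mfd" and g :: "('m, 'n) metric"
    and N :: nat and U V :: "nat \<Rightarrow> 'm set" and Kdim :: "nat \<Rightarrow> nat"
    and \<phi> :: "nat \<Rightarrow> 'm \<Rightarrow> nat \<Rightarrow> real"
    and S :: "real set" and \<T> :: "real \<Rightarrow> 'm set set" and gh :: "real \<Rightarrow> 'm set \<Rightarrow> ('m, 'n) metric"
    and idx :: "real \<Rightarrow> 'm set \<Rightarrow> nat" and ft :: "real \<Rightarrow> 'm set \<Rightarrow> real^'n \<Rightarrow> nat \<Rightarrow> real"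
    and C K K' :: real
  assumes "manifold_with_corners M" and "oriented M" and "compact_space (mtop M)"
    and "riemannian_metric M g"
    and "\<And>i. i \<in> {1..N} \<Longrightarrow> openin (mtop M) (U i)"
    and "(\<Union>i\<in>{1..N}. U i) = topspace (mtop M)"
    and "\<And>i. i \<in> {1..N} \<Longrightarrow> smooth_embedding_into M (U i) (Kdim i) (\<phi> i)"
    and "\<And>i. i \<in> {1..N} \<Longrightarrow> closedin (mtop M) (V i) \<and> V i \<subseteq> U i"
    and "(\<Union>i\<in>{1..N}. V i) = topspace (mtop M)"
    and "\<And>h. h \<in> S \<Longrightarrow> smooth_triangulation M (\<T> h)"
    and "\<And>h. h \<in> S \<Longrightarrow> regge_metric M (\<T> h) (gh h)"
    and size: "parametrized_by_size S (\<lambda>h. M) \<T> gh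
           (\<lambda>h T. inv_into (U (idx h T)) (\<phi> (idx h T)) \<circ> ft h T)"
    and cond1: "\<And>h. h \<in> S \<Longrightarrow>
           comparison M g (regge_field M (\<T> h) (gh h)) (topspace (mtop M)) *
           comparison M (regge_field M (\<T> h) (gh h)) g (topspace (mtop M)) \<le> ereal C"
    and cond2: "\<And>h T. h \<in> S \<Longrightarrow> T \<in> n_simplices M (\<T> h) \<Longrightarrow> idx h T \<in> {1..N} \<and> T \<subseteq> V (idx h T)"
    and cond3: "\<And>h T. h \<in> S \<Longrightarrow> T \<in> n_simplices M (\<T> h) \<Longrightarrow>
           affine_map_into (Kdim (idx h T)) (ft h T) \<and> inj (ft h T) \<and>
           ft h T ` std_simplex UNIV = \<phi> (idx h T) ` T"
    and K_pos: "0 < K"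
    and cond4: "\<And>h T. h \<in> S \<Longrightarrow> T \<in> n_simplices M (\<T> h) \<Longrightarrow>
           (SUP v\<in>UNIV - {0}. stretch (Kdim (idx h T)) (ft h T) v) /
           (INF w\<in>UNIV - {0}. stretch (Kdim (idx h T)) (ft h T) w) \<le> K"
    and cond5: "\<And>h T. h \<in> S \<Longrightarrow> T \<in> n_simplices M (\<T> h) \<Longrightarrow> comparison M g (gh h T) T \<le> ereal C"
    and K'_pos: "0 < K'"
    and cond6: "\<And>h T. h \<in> S \<Longrightarrow> T \<in> n_simplices M (\<T> h) \<Longrightarrow>
           0 < 1 / K' * h \<and>
           1 / K' * h \<le> (INF v\<in>UNIV - {0}. stretch (Kdim (idx h T)) (ft h T) v)"
  shows "quasi_uniform S (\<lambda>h. M) \<T> gh"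
proof -
  have "\<exists>B>0. \<forall>p\<in>V i. embedded_region.dominates_embedding M (U i) (Kdim i) (\<phi> i) g B p"
    if i: "i \<in> {1..N}" for i
  proof -
    interpret embedded_region M "U i" "Kdim i" "\<phi> i"
      by unfold_locales (use assms(1) assms(5)[OF i] assms(7)[OF i] in auto)
    have Vi: "compactin (mtop M) (V i)" "V i \<subseteq> U i"
      using assms(8)[OF i] closedin_compact_space[OF assms(3)] by blast+
    show ?thesis
      by (rule embedding_bound_on_compact[OF assms(4) Vi]) blast
  qed
  then obtain B where B: "\<And>i. i \<in> {1..N} \<Longrightarrow> 0 < (B i :: real)"
    "\<And>i p. i \<in> {1..N} \<Longrightarrow> p \<in> V i \<Longrightarrow> embedded_region.dominates_embedding M (U i) (Kdim i) (\<phi> i) g (B i) p"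
    by metis
  \<comment> \<open>The sum over the finitely many regions replaces the maximum of the \<open>B i\<close>.\<close>
  define L where "L = (1 + sum B {1..N}) * K' * (max C 0 + 1)"
  have "0 \<le> sum B {1..N}" using B(1) by (intro sum_nonneg) (auto intro: less_imp_le)
  then have L: "0 < L" using K'_pos by (simp add: L_def)
  let ?f0 = "\<lambda>h T. inv_into (U (idx h T)) (\<phi> (idx h T)) \<circ> ft h T"
  have h_pos: "0 < h" if hT: "h \<in> S" "T \<in> n_simplices M (\<T> h)" for h T
    using cond6[OF hT] K'_pos by (simp add: zero_less_divide_iff)
  have "\<exists>f'. diffeo_simplex M f' T \<and> orientation_preserving M f' \<and>
      comparison M (gh h T) (hat_metric M f') T = comparison M (gh h T) (hat_metric M (?f0 h T)) T \<and>
      0 \<le> comparison M (gh h T) (hat_metric M f') T \<and> 0 \<le> comparison M (hat_metric M f') (gh h T) T \<and>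
      comparison M (hat_metric M f') (gh h T) T \<le> ereal (L * inverse h)"
    if hT: "h \<in> S" "T \<in> n_simplices M (\<T> h)" for h T
  proof -
    define i where "i = idx h T"
    have i: "i \<in> {1..N}" "T \<subseteq> V i" using cond2[OF hT] by (simp_all add: i_def)
    interpret affine_reference_map M "U i" "Kdim i" "\<phi> i" T "ft h T"
    proof unfold_locales
      show "manifold_with_corners M" by (rule assms(1))
      show "openin (mtop M) (U i)" by (rule assms(5)[OF i(1)])
      show "smooth_embedding_into M (U i) (Kdim i) (\<phi> i)" by (rule assms(7)[OF i(1)])
      show "T \<subseteq> U i" using assms(8)[OF i(1)] i(2) by blast
    qed (use cond3[OF hT] in \<open>simp_all add: i_def\<close>)
    define m where "m = 1 / K' * h"
    have m: "0 < m" using cond6[OF hT] by (simp add: m_def)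
    have stretch: "m \<le> stretch (Kdim i) (ft h T) v" if "v \<noteq> 0" for v
    proof -
      have "bdd_below (stretch (Kdim i) (ft h T) ` (UNIV - {0}))"
        by (rule bdd_belowI[of _ 0]) (auto simp: stretch_def L2_set_nonneg)
      then have "(INF v\<in>UNIV - {0}. stretch (Kdim i) (ft h T) v) \<le> stretch (Kdim i) (ft h T) v"
        by (rule cINF_lower) (use that in simp)
      then show ?thesis using cond6[OF hT] unfolding m_def i_def by linarith
    qed
    have dom: "dominates_embedding g (B i) p" if "p \<in> T" for p using B(2)[OF i(1)] i(2) that by blast
    have pos: "\<exists>X\<in>tangent_space M p - {\<lambda>_. 0}. 0 < metric_norm (gh h T) p X" if "p \<in> T" for p
      by (rule regge_metric_norm_positive[OF assms(1) assms(11)[OF hT(1)] hT(2) that])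
    obtain f' where f': "diffeo_simplex M f' T" "orientation_preserving M f'"
      "comparison M (gh h T) (hat_metric M f') T = comparison M (gh h T) (hat_metric M f) T"
      "0 \<le> comparison M (gh h T) (hat_metric M f') T" "0 \<le> comparison M (hat_metric M f') (gh h T) T"
      and le: "comparison M (hat_metric M f') (gh h T) T \<le> ereal (B i / m * (max C 0 + 1))"
      by (rule oriented_reference_map_bounds[OF assms(2) assms(4) pos m stretch B(1)[OF i(1)] dom cond5[OF hT]];
          (assumption | rule that))
    have "B i \<le> sum B {1..N}"
      by (rule member_le_sum[OF i(1)]) (use B(1) in \<open>auto intro: less_imp_le\<close>)
    then have "B i \<le> 1 + sum B {1..N}" by simp
    then have "B i / m * (max C 0 + 1) \<le> (1 + sum B {1..N}) / m * (max C 0 + 1)"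
      using m by (intro mult_right_mono divide_right_mono) auto
    also have "\<dots> = L * inverse h" using K'_pos h_pos[OF hT] by (simp add: L_def m_def field_simps)
    finally have "ereal (B i / m * (max C 0 + 1)) \<le> ereal (L * inverse h)" by simp
    with le have "comparison M (hat_metric M f') (gh h T) T \<le> ereal (L * inverse h)" by (rule order_trans)
    with f' show ?thesis unfolding i_def by blast
  qed
  then obtain F where F: "\<And>h T. h \<in> S \<Longrightarrow> T \<in> n_simplices M (\<T> h) \<Longrightarrow>
      diffeo_simplex M (F h T) T \<and> orientation_preserving M (F h T) \<and>
      comparison M (gh h T) (hat_metric M (F h T)) T = comparison M (gh h T) (hat_metric M (?f0 h T)) T \<and>
      0 \<le> comparison M (gh h T) (hat_metric M (F h T)) T \<and> 0 \<le> comparison M (hat_metric M (F h T)) (gh h T) T \<and>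
      comparison M (hat_metric M (F h T)) (gh h T) T \<le> ereal (L * inverse h)"
    by metis
  have sizeF: "parametrized_by_size S (\<lambda>h. M) \<T> gh F"
    using size F unfolding parametrized_by_size_def by (metis (no_types, lifting))
  have "comparison M (gh h T) (hat_metric M (F h T)) T * comparison M (hat_metric M (F h T)) (gh h T) T \<le> ereal L"
    if hT: "h \<in> S" "T \<in> n_simplices M (\<T> h)" for h T
  proof -
    have "comparison M (gh h T) (hat_metric M (F h T)) T \<le> ereal h"
      using sizeF hT unfolding parametrized_by_size_def by blast
    then have "comparison M (gh h T) (hat_metric M (F h T)) T * comparison M (hat_metric M (F h T)) (gh h T) T
        \<le> ereal h * comparison M (hat_metric M (F h T)) (gh h T) T"
      using F[OF hT] by (intro ereal_mult_right_mono) auto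
    also have "\<dots> \<le> ereal h * ereal (L * inverse h)"
      using F[OF hT] h_pos[OF hT] by (intro ereal_mult_left_mono) auto
    also have "\<dots> = ereal L" using h_pos[OF hT] by simp
    finally show ?thesis .
  qed
  then have "shape_regular_with S (\<lambda>h. M) \<T> gh F"
    unfolding shape_regular_with_def using L F by (intro exI[of _ L]) blast
  with sizeF show ?thesis
    unfolding quasi_uniform_def using L F by (intro exI[of _ F] conjI exI[of _ L]) blast+
qed

end
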